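(* Let $F$ be a field satisfying the following two conditions: (1) the field $F(\sqrt{-1})$ has no quadratic extension; and (2) each nonlinear polynomial of odd degree in $F[x]$ is reducible in $F[x]$. Then $F(\sqrt{-1})$ is algebraically closed.
   Context: $F$ is an arbitrary field (no assumption on its characteristic). $F(\sqrt{-1})$ denotes the field obtained from $F$ by adjoining a root of $x^2+1$ (inside a fixed algebraic closure of $F$); the possibility $F(\sqrt{-1})=F$ is allowed. A quadratic extension of a field is a field extension of degree $2$ (separable or not). A nonlinear polynomial of odd degree is a polynomial of odd degree greater than $1$. *)

theory Defs
  imports "HOL-Algebra.Algebraic_Closure" "HOL-Algebra.Generated_Fields"
begin

text \<open>
  Field extensions are chains of subfields of one ambient field \<open>R\<close>, in the statement an
  algebraic closure of the base field. A quadratic extension, separable or not, is algebraic,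
  so a subfield of an algebraic closure has a quadratic extension exactly if it has one inside
  that closure.
\<close>

definition (in ring) quadratic_extension :: "'a set \<Rightarrow> 'a set \<Rightarrow> bool"
  where "quadratic_extension K E \<longleftrightarrow>
    subfield K R \<and> subfield E R \<and> K \<subseteq> E \<and> (dimension 2 over K) E"

end

(* The roots of finitely many polynomials generate an extension E of F, with a finite group G of
   automorphisms over F. An element fixed by G is the only root of its minimal polynomial, so it is
   purely inseparable over F; if it is not in F, then its degree over F is a power of the
   characteristic, hence even by (2), and the characteristic is 2. But then F(i) = F has no
   quadratic extension and is closed under square roots. Hence F is the fixed field of G.

   The polynomial whose roots are the orbit of an element under a group H has its coefficients in
   the fixed field of H. Under G, the orbit of an element fixed by a Sylow 2-subgroup P has odd
   size, so this polynomial has a root in F by (2) and the element is in F: F is the fixed field of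
   P, too. The stabilizer Q of i in P is a 2-group with fixed field in F(i). If Q is not trivial,
   then a subgroup of index 2 either has the same fixed field or gives an orbit of size 2 and with
   it a quadratic extension of F(i). So one may descend to the trivial group, whence E = F(i).
   Since only orbits are counted, neither the primitive element theorem nor Artin's theorem on
   fixed fields is used. *)

theory Submission
  imports Defs "HOL-Algebra.Group_Action" "HOL-Algebra.Sylow"
begin

subsection \<open>Orbit polynomials and fixed fields\<close>

declare (in ring) poly_add.simps [simp del] poly_mult.simps [simp del]

text \<open>A homomorphism of fields kills no leading coefficient, so the coefficientwise image is
  again normalized. Hence the rules for \<open>poly_mult\<close> and \<open>poly_add\<close>, which
  hold up to \<open>normalize\<close>, hold exactly.\<close>

lemma map_ring_hom_poly_ring:
  assumes "h \<in> ring_hom R S" "field R" "field S"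
  shows "map h \<in> ring_hom (poly_ring R) (poly_ring S)"
proof -
  interpret R: field R by fact
  interpret S: field S by fact
  interpret ring_hom_ring R S h
    using ring_hom_ringI2[OF R.ring_axioms S.ring_axioms assms(1)] .
  have closed: "map h p \<in> carrier (poly_ring S)" if "p \<in> carrier (poly_ring R)" for p
    using polynomial_hom[OF assms] that by blast
  have set: "set p \<subseteq> carrier R" if "p \<in> carrier (poly_ring R)" for p
    using that by (simp add: R.polynomial_incl flip: univ_poly_carrier)
  have norm: "S.normalize (map h p) = map h p" if "p \<in> carrier (poly_ring R)" for p
    using closed[OF that] S.normalize_polynomial by (simp flip: univ_poly_carrier)
  interpret PR: domain "poly_ring R"
    using R.univ_poly_is_domain[OF R.carrier_is_subring] .
  show ?thesis
  proof (rule ring_hom_memI)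
    fix p q assume p: "p \<in> carrier (poly_ring R)" and q: "q \<in> carrier (poly_ring R)"
    show "map h (p \<otimes>\<^bsub>poly_ring R\<^esub> q) = map h p \<otimes>\<^bsub>poly_ring S\<^esub> map h q"
      using poly_mult_hom'[OF set[OF p] set[OF q]] norm[OF PR.m_closed[OF p q]]
      by (simp add: univ_poly_mult)
    show "map h (p \<oplus>\<^bsub>poly_ring R\<^esub> q) = map h p \<oplus>\<^bsub>poly_ring S\<^esub> map h q"
      using poly_add_hom'[OF set[OF p] set[OF q]] norm[OF PR.a_closed[OF p q]]
      by (simp add: univ_poly_add)
  qed (auto simp: closed univ_poly_one)
qed

text \<open>The product runs over a set, so each root comes from one factor and the degree counts
  the roots. It is later taken over an orbit.\<close>

lemma (in domain) finprod_linear_factors: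
  assumes "finite S" "S \<subseteq> carrier R"
  defines "p \<equiv> (\<Otimes>\<^bsub>poly_ring R\<^esub>y\<in>S. [\<one>, \<ominus> y])"
  shows "p \<in> carrier (poly_ring R)" "p \<noteq> []" "degree p = card S"
    and "\<And>z. z \<in> carrier R \<Longrightarrow> eval p z = \<zero> \<longleftrightarrow> z \<in> S"
proof -
  interpret P: domain "poly_ring R"
    using univ_poly_is_domain[OF carrier_is_subring] .
  have lin: "[\<one>, \<ominus> y] \<in> carrier (poly_ring R)" if "y \<in> carrier R" for y
    using that by (simp add: polynomial_def flip: univ_poly_carrier)
  have "p \<in> carrier (poly_ring R) \<and> p \<noteq> [] \<and> degree p = card S \<and>
      (\<forall>z\<in>carrier R. eval p z = \<zero> \<longleftrightarrow> z \<in> S)"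
    using assms(1,2) unfolding p_def
  proof (induction S)
    case empty
    show ?case by (simp add: univ_poly_one polynomial_def flip: univ_poly_carrier)
  next
    case (insert y S)
    let ?q = "\<Otimes>\<^bsub>poly_ring R\<^esub>y\<in>S. [\<one>, \<ominus> y]"
    have y: "y \<in> carrier R" and q: "?q \<in> carrier (poly_ring R)" "?q \<noteq> []" "degree ?q = card S"
      "\<forall>z\<in>carrier R. eval ?q z = \<zero> \<longleftrightarrow> z \<in> S"
      using insert by auto
    have eq: "(\<Otimes>\<^bsub>poly_ring R\<^esub>y\<in>insert y S. [\<one>, \<ominus> y]) = [\<one>, \<ominus> y] \<otimes>\<^bsub>poly_ring R\<^esub> ?q"
      using insert lin by (intro P.finprod_insert) auto
    have ne: "[\<one>, \<ominus> y] \<otimes>\<^bsub>poly_ring R\<^esub> ?q \<noteq> []"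
      using P.integral[OF _ lin[OF y] q(1)] q(2) by (auto simp: univ_poly_zero)
    have deg: "degree ([\<one>, \<ominus> y] \<otimes>\<^bsub>poly_ring R\<^esub> ?q) = Suc (card S)"
      using poly_mult_degree_eq[OF carrier_is_subring, of "[\<one>, \<ominus> y]" ?q] lin[OF y] q
        length_greater_0_conv[of ?q]
      by (simp add: univ_poly_mult univ_poly_carrier del: length_greater_0_conv)
    have "eval ([\<one>, \<ominus> y] \<otimes>\<^bsub>poly_ring R\<^esub> ?q) z = (z \<ominus> y) \<otimes> eval ?q z" if "z \<in> carrier R" for z
      using ring_hom_memE(2)[OF eval_is_hom[OF carrier_is_subring that] lin[OF y] q(1)] that y
      by (simp add: a_minus_def)
    moreover have "eval ?q z \<in> carrier R" if "z \<in> carrier R" for z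
      using ring_hom_memE(1)[OF eval_is_hom[OF carrier_is_subring that] q(1)] .
    ultimately have "eval ([\<one>, \<ominus> y] \<otimes>\<^bsub>poly_ring R\<^esub> ?q) z = \<zero> \<longleftrightarrow> z \<in> insert y S"
      if "z \<in> carrier R" for z
      using that y q(4) integral_iff[of "z \<ominus> y" "eval ?q z"] by auto
    then show ?case
      unfolding eq using insert.hyps lin[OF y] q(1) ne deg by auto
  qed
  then show "p \<in> carrier (poly_ring R)" "p \<noteq> []" "degree p = card S"
    "\<And>z. z \<in> carrier R \<Longrightarrow> eval p z = \<zero> \<longleftrightarrow> z \<in> S" by auto
qed

section \<open>Automorphisms and their fixed points\<close>

definition (in ring) fixed_points :: "('a \<Rightarrow> 'a) set \<Rightarrow> 'a set"
  where "fixed_points H = {x \<in> carrier R. \<forall>\<phi>\<in>H. \<phi> x = x}"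

lemma (in ring) fixed_points_antimono: "H \<subseteq> H' \<Longrightarrow> fixed_points H' \<subseteq> fixed_points H"
  by (auto simp: fixed_points_def)

text \<open>\<open>Bij\<close> contains only extensional functions, so automorphisms that agree on
  the carrier are equal, and \<open>BijGroup\<close> provides the group operations.\<close>

definition (in ring) automorphisms_over :: "'a set \<Rightarrow> ('a \<Rightarrow> 'a) set"
  where "automorphisms_over K = {f \<in> Bij (carrier R). f \<in> ring_hom R R \<and> (\<forall>a\<in>K. f a = a)}"

lemma (in ring) subgroup_automorphisms_over:
  assumes "K \<subseteq> carrier R"
  shows "subgroup (automorphisms_over K) (BijGroup (carrier R))"
proof (rule subgroup.intro)
  show "automorphisms_over K \<subseteq> carrier (BijGroup (carrier R))"
    by (auto simp: automorphisms_over_def BijGroup_def)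
  show "\<one>\<^bsub>BijGroup (carrier R)\<^esub> \<in> automorphisms_over K"
    using assms by (auto simp: automorphisms_over_def BijGroup_def id_Bij ring_hom_def)
next
  fix f g assume fg: "f \<in> automorphisms_over K" "g \<in> automorphisms_over K"
  then have "compose (carrier R) f g \<in> ring_hom R R"
    by (auto simp: automorphisms_over_def ring_hom_def compose_def Pi_def)
  moreover have "compose (carrier R) f g \<in> Bij (carrier R)"
    using fg by (auto simp: automorphisms_over_def intro: compose_Bij)
  moreover have "compose (carrier R) f g a = a" if "a \<in> K" for a
    using fg that assms by (auto simp: automorphisms_over_def compose_def)
  ultimately show "f \<otimes>\<^bsub>BijGroup (carrier R)\<^esub> g \<in> automorphisms_over K"
    using fg by (auto simp: automorphisms_over_def BijGroup_def)
next
  fix f assume f: "f \<in> automorphisms_over K"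
  then have bij: "f \<in> Bij (carrier R)" and hom: "f \<in> ring_hom R R" and fixed: "\<forall>a\<in>K. f a = a"
    by (auto simp: automorphisms_over_def)
  have inj: "inj_on f (carrier R)"
    using bij by (simp add: Bij_def bij_betw_def)
  have inv: "inv_into (carrier R) f a = a" if "a \<in> K" for a
    using inv_into_f_f[OF inj, of a] fixed assms that by auto
  have one: "inv_into (carrier R) f \<one> = \<one>"
    using inv_into_f_f[OF inj one_closed] ring_hom_memE(4)[OF hom] by simp
  have "restrict (inv_into (carrier R) f) (carrier R) \<in> ring_hom R R"
  proof (rule ring_hom_memI)
    fix x y assume "x \<in> carrier R" "y \<in> carrier R"
    then show "restrict (inv_into (carrier R) f) (carrier R) (x \<otimes> y) =
        restrict (inv_into (carrier R) f) (carrier R) x \<otimes> restrict (inv_into (carrier R) f) (carrier R) y"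
      "restrict (inv_into (carrier R) f) (carrier R) (x \<oplus> y) =
        restrict (inv_into (carrier R) f) (carrier R) x \<oplus> restrict (inv_into (carrier R) f) (carrier R) y"
      using Bij_inv_into_lemma[OF _ bij, of "(\<otimes>)" x y] Bij_inv_into_lemma[OF _ bij, of "(\<oplus>)" x y]
        ring_hom_memE[OF hom] by (auto simp: Pi_def)
  qed (use Bij_inv_into_mem[OF bij] one in auto)
  then show "inv\<^bsub>BijGroup (carrier R)\<^esub> f \<in> automorphisms_over K"
    using inv assms restrict_inv_into_Bij[OF bij]
    by (auto simp: inv_BijGroup[OF bij] automorphisms_over_def)
qed

section \<open>Finite groups of automorphisms of a field\<close>

locale finite_automorphism_group = field R for R (structure) +
  fixes H :: "('a \<Rightarrow> 'a) set"
  assumes subgroup_BijGroup: "subgroup H (BijGroup (carrier R))"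
    and ring_homs: "H \<subseteq> ring_hom R R"
    and finite_group: "finite H"
begin

abbreviation "HG \<equiv> BijGroup (carrier R)\<lparr>carrier := H\<rparr>"

lemma group_HG: "group HG"
  using subgroup.subgroup_is_group[OF subgroup_BijGroup group_BijGroup] .

lemma Bij: "\<phi> \<in> H \<Longrightarrow> \<phi> \<in> Bij (carrier R)"
  using subgroup.subset[OF subgroup_BijGroup] by (auto simp: BijGroup_def)

text \<open>The group consists of permutations of the carrier, so the identity map is its action.
  This gives access to orbits, stabilizers and the orbit-stabilizer theorem.\<close>

lemma action: "group_action HG (carrier R) (\<lambda>\<phi>. \<phi>)"
proof (intro group_action.intro group_hom.intro group_hom_axioms.intro group_HG group_BijGroup)
  show "(\<lambda>\<phi>. \<phi>) \<in> hom HG (BijGroup (carrier R))"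
    using subgroup.subset[OF subgroup_BijGroup] by (auto simp: hom_def)
qed

lemma hom_app: "\<phi> \<in> H \<Longrightarrow> \<phi> \<in> ring_hom R R"
  using ring_homs by blast

lemma ring_hom_cring_app: "\<phi> \<in> H \<Longrightarrow> ring_hom_cring R R \<phi>"
  by (intro ring_hom_cringI is_cring hom_app)

lemma closed: "\<phi> \<in> H \<Longrightarrow> x \<in> carrier R \<Longrightarrow> \<phi> x \<in> carrier R"
  using ring_hom_memE(1)[OF hom_app] .

abbreviation "orb \<equiv> orbit HG (\<lambda>\<phi>. \<phi>)"
abbreviation "stab \<equiv> stabilizer HG (\<lambda>\<phi>. \<phi>)"

lemma orb_eq: "orb x = (\<lambda>\<phi>. \<phi> x) ` H"
  by (auto simp: orbit_def)

lemma orb_refl: "x \<in> carrier R \<Longrightarrow> x \<in> orb x"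
  by (rule group_action.orbit_refl[OF action])

lemma orb_carrier: "x \<in> carrier R \<Longrightarrow> orb x \<subseteq> carrier R"
  by (auto simp: orb_eq closed)

lemma finite_orb: "finite (orb x)"
  by (simp add: orb_eq finite_group)

lemma comp_app: "\<phi> \<in> H \<Longrightarrow> \<psi> \<in> H \<Longrightarrow> \<exists>\<rho>\<in>H. \<forall>x\<in>carrier R. \<rho> x = \<phi> (\<psi> x)"
  using group_action.composition_rule[OF action] monoid.m_closed[OF group.is_monoid[OF group_HG]]
  by (metis partial_object.select_convs(1) partial_object.surjective partial_object.update_convs(1))

lemma inv_app: "\<phi> \<in> H \<Longrightarrow> \<exists>\<rho>\<in>H. \<forall>x\<in>carrier R. \<rho> (\<phi> x) = x"
  using group_action.orbit_sym_aux[OF action] group.inv_closed[OF group_HG]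
  by (metis partial_object.select_convs(1) partial_object.surjective partial_object.update_convs(1))

text \<open>Closure under composition keeps the image inside the orbit, and an injective map of a
  finite set into itself is onto.\<close>

lemma image_orb:
  assumes "\<phi> \<in> H" "x \<in> carrier R"
  shows "\<phi> ` orb x = orb x"
proof (rule card_subset_eq)
  have "inj_on \<phi> (orb x)"
    using Bij[OF assms(1)] orb_carrier[OF assms(2)]
    by (auto simp: Bij_def bij_betw_def intro: inj_on_subset)
  then show "card (\<phi> ` orb x) = card (orb x)"
    by (rule card_image)
  show "\<phi> ` orb x \<subseteq> orb x"
  proof
    fix z assume "z \<in> \<phi> ` orb x"
    then obtain \<psi> where "\<psi> \<in> H" "z = \<phi> (\<psi> x)"
      by (auto simp: orb_eq)
    then obtain \<rho> where "\<rho> \<in> H" "\<rho> x = z"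
      using comp_app[OF assms(1), of \<psi>] assms(2) by blast
    then show "z \<in> orb x"
      by (auto simp: orb_eq)
  qed
qed (rule finite_orb)

lemma subfield_fixed_points: "subfield (fixed_points H) R"
proof (rule subfieldI'[OF subringI])
  fix x y assume "x \<in> fixed_points H" "y \<in> fixed_points H"
  then have xy: "x \<in> carrier R" "y \<in> carrier R" and fixed: "\<forall>\<phi>\<in>H. \<phi> x = x \<and> \<phi> y = y"
    by (auto simp: fixed_points_def)
  have "\<forall>\<phi>\<in>H. \<phi> (x \<otimes> y) = x \<otimes> y \<and> \<phi> (x \<oplus> y) = x \<oplus> y \<and> \<phi> (\<ominus> x) = \<ominus> x"
  proof
    fix \<phi> assume that: "\<phi> \<in> H"
    then have "\<phi> x = x" "\<phi> y = y" using fixed that by auto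
    then show "\<phi> (x \<otimes> y) = x \<otimes> y \<and> \<phi> (x \<oplus> y) = x \<oplus> y \<and> \<phi> (\<ominus> x) = \<ominus> x"
      using ring_hom_memE(2,3)[OF hom_app[OF that] xy]
        ring_hom_cring.hom_a_inv[OF ring_hom_cring_app[OF that] xy(1)] by simp
  qed
  then show "x \<otimes> y \<in> fixed_points H" "x \<oplus> y \<in> fixed_points H" "\<ominus> x \<in> fixed_points H"
    using xy by (auto simp: fixed_points_def)
next
  fix x assume x: "x \<in> fixed_points H - {\<zero>}"
  then have xc: "x \<in> carrier R" "x \<noteq> \<zero>" "\<forall>\<phi>\<in>H. \<phi> x = x"
    by (auto simp: fixed_points_def)
  have ix: "inv x \<in> carrier R" "x \<otimes> inv x = \<one>"
    using field_Units xc by auto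
  have "\<phi> (inv x) = inv x" if s: "\<phi> \<in> H" for \<phi>
  proof -
    have "\<phi> x = x"
      using xc s by blast
    then have "x \<otimes> \<phi> (inv x) = \<phi> (x \<otimes> inv x)"
      using ring_hom_memE(2)[OF hom_app[OF s] xc(1) ix(1)] by simp
    also have "\<dots> = x \<otimes> inv x"
      using ring_hom_memE(4)[OF hom_app[OF s]] ix by simp
    finally show ?thesis
      using m_lcancel[OF xc(2,1) closed[OF s ix(1)] ix(1)] by simp
  qed
  then show "inv x \<in> fixed_points H"
    using ix by (auto simp: fixed_points_def)
qed (use ring_hom_memE(4)[OF hom_app] in \<open>auto simp: fixed_points_def\<close>)

text \<open>An automorphism in \<open>H\<close> only permutes the factors \<open>X - y\<close> of
  the product over the orbit, so it fixes the product and, with it, each coefficient.\<close>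

lemma orbit_polynomial:
  assumes x: "x \<in> carrier R"
  obtains p where "p \<in> carrier ((fixed_points H)[X])" "degree p = card (orb x)"
    and "\<And>z. z \<in> carrier R \<Longrightarrow> eval p z = \<zero> \<longleftrightarrow> z \<in> orb x"
proof -
  let ?P = "poly_ring R"
  interpret P: domain ?P
    using univ_poly_is_domain[OF carrier_is_subring] .
  define p where "p = (\<Otimes>\<^bsub>?P\<^esub>y\<in>orb x. [\<one>, \<ominus> y])"
  note p = finprod_linear_factors[OF finite_orb orb_carrier[OF x], folded p_def]
  have lin: "[\<one>, \<ominus> y] \<in> carrier ?P" if "y \<in> carrier R" for y
    using that by (simp add: polynomial_def flip: univ_poly_carrier)
  have "map \<phi> p = p" if s: "\<phi> \<in> H" for \<phi>
  proof -
    interpret M: ring_hom_cring ?P ?P "map \<phi>"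
      by (intro ring_hom_cringI P.is_cring map_ring_hom_poly_ring hom_app s field_axioms)
    have "map \<phi> p = (\<Otimes>\<^bsub>?P\<^esub>y\<in>orb x. map \<phi> [\<one>, \<ominus> y])"
      unfolding p_def using lin orb_carrier[OF x]
      by (subst M.hom_finprod) (auto simp: comp_def)
    also have "\<dots> = (\<Otimes>\<^bsub>?P\<^esub>y\<in>orb x. [\<one>, \<ominus> \<phi> y])"
      using orb_carrier[OF x] lin closed[OF s] ring_hom_memE(4)[OF hom_app[OF s]]
        ring_hom_cring.hom_a_inv[OF ring_hom_cring_app[OF s]]
      by (intro P.finprod_cong') auto
    also have "\<dots> = (\<Otimes>\<^bsub>?P\<^esub>y\<in>\<phi> ` orb x. [\<one>, \<ominus> y])"
      using orb_carrier[OF x] lin closed[OF s] Bij[OF s]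
      by (intro P.finprod_reindex[symmetric]) (auto simp: Bij_def bij_betw_def intro: inj_on_subset)
    finally show ?thesis
      by (simp add: image_orb[OF s x] p_def)
  qed
  then have "\<forall>\<phi>\<in>H. \<forall>a\<in>set p. \<phi> a = a"
    by (metis map_eq_conv map_ident)
  moreover have "set p \<subseteq> carrier R" "lead_coeff p \<noteq> \<zero>"
    using p(1,2) by (auto simp: polynomial_def simp flip: univ_poly_carrier)
  ultimately have "p \<in> carrier ((fixed_points H)[X])"
    by (auto simp: polynomial_def fixed_points_def simp flip: univ_poly_carrier)
  then show ?thesis
    using that p by blast
qed

lemma fixed_pointI:
  assumes x: "x \<in> carrier R" and "card (orb x) = 1"
  shows "x \<in> fixed_points H"
proof -
  have "orb x = {x}"
    using orb_refl[OF x] assms(2) by (metis card_1_singletonE singletonD)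
  then show ?thesis
    using x by (auto simp: fixed_points_def orb_eq)
qed

lemma orbit_stabilizer: "x \<in> carrier R \<Longrightarrow> card (orb x) * card (stab x) = card H"
  using group_action.orbit_stabilizer_theorem[OF action] by (simp add: order_def)

lemma subgroup_automorphism_group:
  assumes "subgroup H' HG"
  shows "finite_automorphism_group R H'"
proof (intro finite_automorphism_group.intro finite_automorphism_group_axioms.intro field_axioms)
  show "subgroup H' (BijGroup (carrier R))"
    using group.incl_subgroup[OF group_BijGroup subgroup_BijGroup assms] .
  have "H' \<subseteq> H"
    using subgroup.subset[OF assms] by simp
  then show "H' \<subseteq> ring_hom R R" "finite H'"
    using ring_homs finite_group finite_subset by blast+
qed

text \<open>Lagrange's theorem within the stabilizer, which contains \<open>H'\<close>. Together
  with \<open>orbit_stabilizer\<close> it makes the size of the orbit divide the index of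
  \<open>H'\<close>.\<close>

lemma card_orb_dvd:
  assumes "subgroup H' HG" "x \<in> fixed_points H'"
  shows "card H' dvd card (stab x)"
proof -
  have x: "x \<in> carrier R" and "H' \<subseteq> stab x"
    using assms subgroup.subset[OF assms(1)] by (auto simp: fixed_points_def stabilizer_def)
  then have "subgroup H' (HG\<lparr>carrier := stab x\<rparr>)"
    using group.subgroup_incl[OF group_HG assms(1) group_action.stabilizer_subgroup[OF action x]]
    by simp
  then have "card (rcosets\<^bsub>HG\<lparr>carrier := stab x\<rparr>\<^esub> H') * card H' = order (HG\<lparr>carrier := stab x\<rparr>)"
    using group.lagrange subgroup.subgroup_is_group[OF group_action.stabilizer_subgroup[OF action x] group_HG]
    by blast
  then show ?thesis
    by (simp add: order_def) (metis dvd_triv_right)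
qed

lemma subgroup_stab: "x \<in> carrier R \<Longrightarrow> subgroup (stab x) HG"
  by (rule group_action.stabilizer_subgroup[OF action])

text \<open>The size of the orbit of \<open>x\<close> divides the odd number \<open>m\<close>, so
  the orbit polynomial has a root fixed by \<open>H\<close>. This root lies in the orbit of
  \<open>x\<close>, and the orbit of a fixed point is a singleton.\<close>

lemma sylow_fixed_points:
  assumes P: "subgroup P HG" "card P = 2 ^ a" and H: "card H = 2 ^ a * m" "odd m"
    and root: "\<And>p. p \<in> carrier ((fixed_points H)[X]) \<Longrightarrow> odd (degree p) \<Longrightarrow>
      \<exists>x\<in>fixed_points H. eval p x = \<zero>"
  shows "fixed_points P = fixed_points H"
proof
  show "fixed_points H \<subseteq> fixed_points P"
    using subgroup.subset[OF P(1)] by (intro fixed_points_antimono) auto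
  show "fixed_points P \<subseteq> fixed_points H"
  proof
    fix x assume x: "x \<in> fixed_points P"
    then have xc: "x \<in> carrier R" by (simp add: fixed_points_def)
    obtain k where "card (stab x) = 2 ^ a * k"
      using card_orb_dvd[OF P(1) x] P(2) by (auto elim: dvdE)
    then have "card (orb x) * k = m"
      using orbit_stabilizer[OF xc] H(1) by simp
    then have odd: "odd (card (orb x))"
      using H(2) by auto
    obtain p where p: "p \<in> carrier ((fixed_points H)[X])" "degree p = card (orb x)"
      "\<And>z. z \<in> carrier R \<Longrightarrow> eval p z = \<zero> \<longleftrightarrow> z \<in> orb x"
      using orbit_polynomial[OF xc] by blast
    obtain y where y: "y \<in> fixed_points H" "eval p y = \<zero>"
      using root[OF p(1), unfolded p(2), OF odd] by blast
    then have yc: "y \<in> carrier R" by (simp add: fixed_points_def)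
    then have "x \<in> orb y"
      using group_action.orbit_sym[OF action xc yc] p(3)[OF yc] y(2) by simp
    then have "x = y"
      using y(1) by (auto simp: orb_eq fixed_points_def)
    then show "x \<in> fixed_points H"
      using y(1) by simp
  qed
qed

text \<open>If \<open>\<psi>\<close> moves \<open>i\<close>, then it represents the only other coset of the stabilizer of \<open>i\<close>. So
  \<open>x + \<psi> x\<close> and \<open>i x + \<psi> (i x)\<close> are invariant for \<open>x\<close> fixed by that stabilizer, and \<open>x\<close> is
  a combination of them and \<open>i\<close>.\<close>
lemma fixed_points_stab_sqrt_minus_one:
  assumes i: "i \<in> carrier R" "i \<otimes> i = \<ominus> \<one>"
    and K: "subfield K R" "fixed_points H \<subseteq> K" "i \<in> K"
  shows "fixed_points (stab i) \<subseteq> K"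
proof (cases "stab i = H")
  case True
  then show ?thesis using K(2) by simp
next
  case False
  then obtain \<psi> where psi: "\<psi> \<in> H" "\<psi> i \<noteq> i"
    by (auto simp: stabilizer_def)
  \<comment> \<open>An automorphism permutes the square roots of minus one, and these are
    \<open>i\<close> and its negative.\<close>
  have neg: "\<phi> i = \<ominus> i" if "\<phi> \<in> H" "\<phi> i \<noteq> i" for \<phi>
  proof -
    have c: "\<phi> i \<in> carrier R" using closed that i by blast
    have "\<phi> i \<otimes> \<phi> i = \<phi> (i \<otimes> i)"
      using ring_hom_memE(2)[OF hom_app[OF that(1)] i(1) i(1)] by simp
    also have "\<dots> = \<ominus> \<one>"
      using i ring_hom_memE(4)[OF hom_app[OF that(1)]]
        ring_hom_cring.hom_a_inv[OF ring_hom_cring_app[OF that(1)] one_closed] by simp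
    finally have sq: "\<phi> i \<otimes> \<phi> i = i \<otimes> i" using i by simp
    have "(\<phi> i \<ominus> i) \<otimes> (\<phi> i \<oplus> i) = \<phi> i \<otimes> \<phi> i \<ominus> i \<otimes> i"
      using c i(1) by algebra
    also have "\<dots> = \<zero>"
      unfolding sq using i(1) by simp
    finally have "\<phi> i \<oplus> i = \<zero>"
      using integral[of "\<phi> i \<ominus> i" "\<phi> i \<oplus> i"] c i(1) that(2) by auto
    then show ?thesis
      using c i(1) minus_equality by metis
  qed
  \<comment> \<open>As \<open>\<psi>\<close> moves \<open>i\<close>, the two square roots differ. So
    the characteristic is not 2, and division by \<open>i \<oplus> i\<close> is possible.\<close>
  have two: "i \<oplus> i \<noteq> \<zero>"
    using neg[OF psi] psi(2) i(1) minus_equality by metis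
  obtain \<psi>' where psi': "\<psi>' \<in> H" "\<And>x. x \<in> carrier R \<Longrightarrow> \<psi>' (\<psi> x) = x"
    using inv_app[OF psi(1)] by blast
  have trace: "x \<oplus> \<psi> x \<in> K" if x: "x \<in> fixed_points (stab i)" for x
  proof -
    have xc: "x \<in> carrier R" and fixed: "\<And>\<phi>. \<phi> \<in> H \<Longrightarrow> \<phi> i = i \<Longrightarrow> \<phi> x = x"
      using x by (auto simp: fixed_points_def stabilizer_def)
    have px: "\<psi> x \<in> carrier R" using closed psi(1) xc by blast
    \<comment> \<open>Both \<open>\<phi>\<close> and \<open>\<psi>\<close> negate \<open>i\<close>,
      so \<open>\<psi>'\<close> after \<open>\<phi>\<close> fixes \<open>i\<close> and hence
      \<open>x\<close>.\<close>
    have moved: "\<phi> x = \<psi> x" if phi: "\<phi> \<in> H" "\<phi> i \<noteq> i" for \<phi>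
    proof -
      obtain \<rho> where r: "\<rho> \<in> H" "\<And>x. x \<in> carrier R \<Longrightarrow> \<rho> x = \<psi>' (\<phi> x)"
        using comp_app[OF psi'(1) phi(1)] by blast
      have "\<rho> i = i"
        using r(2)[OF i(1)] neg[OF phi] neg[OF psi] psi'(2)[OF i(1)] by simp
      then have "\<psi>' (\<phi> x) = \<psi>' (\<psi> x)"
        using fixed[OF r(1)] r(2)[OF xc] psi'(2)[OF xc] by simp
      then show ?thesis
        using Bij[OF psi'(1)] closed[OF phi(1) xc] px
        by (auto simp: Bij_def bij_betw_def inj_on_def)
    qed
    have "\<phi> (x \<oplus> \<psi> x) = x \<oplus> \<psi> x" if phi: "\<phi> \<in> H" for \<phi>
    proof -
      obtain \<rho> where r: "\<rho> \<in> H" "\<And>x. x \<in> carrier R \<Longrightarrow> \<rho> x = \<phi> (\<psi> x)"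
        using comp_app[OF phi psi(1)] by blast
      have ri: "\<rho> i = \<ominus> \<phi> i"
        using r(2)[OF i(1)] neg[OF psi] ring_hom_cring.hom_a_inv[OF ring_hom_cring_app[OF phi] i(1)]
        by simp
      have sum: "\<phi> (x \<oplus> \<psi> x) = \<phi> x \<oplus> \<rho> x"
        using r(2)[OF xc] ring_hom_memE(3)[OF hom_app[OF phi] xc px] by simp
      show ?thesis
      \<comment> \<open>Exactly one of \<open>\<phi>\<close> and \<open>\<rho>\<close> fixes
        \<open>i\<close>. If it is \<open>\<phi>\<close>, both summands stay in place; if it is
        \<open>\<rho>\<close>, they are interchanged.\<close>
      proof (cases "\<phi> i = i")
        case True
        then have "\<rho> i \<noteq> i"
          using ri two i(1) by (metis r_neg)
        then show ?thesis
          using sum fixed[OF phi True] moved[OF r(1)] by simp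
      next
        case False
        then have "\<rho> i = i"
          using ri neg[OF phi] i(1) by simp
        then show ?thesis
          using sum fixed[OF r(1)] moved[OF phi False] a_comm[OF xc px] by simp
      qed
    qed
    then show ?thesis
      using K(2) xc px by (auto simp: fixed_points_def)
  qed
  interpret stab: finite_automorphism_group R "stab i"
    using subgroup_automorphism_group[OF subgroup_stab[OF i(1)]] .
  note stabK = subringE[OF subfieldE(1)[OF stab.subfield_fixed_points]]
  note KK = subringE[OF subfieldE(1)[OF K(1)]]
  show ?thesis
  proof
    fix x assume x: "x \<in> fixed_points (stab i)"
    then have xc: "x \<in> carrier R" by (simp add: fixed_points_def)
    have px: "\<psi> x \<in> carrier R" using closed psi(1) xc by blast
    have "i \<in> fixed_points (stab i)"
      using i by (simp add: fixed_points_def stabilizer_def)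
    then have "i \<otimes> x \<oplus> \<psi> (i \<otimes> x) \<in> K"
      using trace stabK(6) x by blast
    moreover have "\<psi> (i \<otimes> x) = \<ominus> i \<otimes> \<psi> x"
      using ring_hom_memE(2)[OF hom_app[OF psi(1)] i(1) xc] neg[OF psi] by simp
    ultimately have "i \<otimes> x \<oplus> \<ominus> i \<otimes> \<psi> x \<in> K" by simp
    moreover have "i \<otimes> (x \<oplus> \<psi> x) \<in> K"
      using KK(6) K(3) trace[OF x] by blast
    ultimately have "(i \<otimes> x \<oplus> \<ominus> i \<otimes> \<psi> x) \<oplus> i \<otimes> (x \<oplus> \<psi> x) \<in> K"
      using KK(7) by blast
    \<comment> \<open>The terms with \<open>\<psi> x\<close> cancel, which leaves \<open>x\<close>
      up to the factor \<open>i \<oplus> i\<close>, a nonzero element of \<open>K\<close>.\<close>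
    moreover have "(i \<otimes> x \<oplus> \<ominus> i \<otimes> \<psi> x) \<oplus> i \<otimes> (x \<oplus> \<psi> x) = (i \<oplus> i) \<otimes> x"
      using i(1) xc px by algebra
    moreover have "i \<oplus> i \<in> K - {\<zero>}"
      using KK(7) K(3) two by blast
    ultimately have "inv (i \<oplus> i) \<otimes> ((i \<oplus> i) \<otimes> x) \<in> K"
      using KK(6) subfield_m_inv(1)[OF K(1)] by auto
    then show "x \<in> K"
      using m_assoc[of "inv (i \<oplus> i)" "i \<oplus> i" x] field_Units two i(1) xc by auto
  qed
qed

end

text \<open>A subgroup of index \<open>2\<close> either has more fixed points, which are then quadratic over \<open>K\<close>, or
  allows to descend.\<close>
lemma (in field) two_group_fixed_points:
  assumes "finite_automorphism_group R H" "card H = 2 ^ n"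
    and K: "ring.fixed_points R H \<subseteq> K" "subring K R"
    and quadratic: "\<And>p x. p \<in> carrier (K[X]) \<Longrightarrow> degree p = 2 \<Longrightarrow> x \<in> carrier R \<Longrightarrow>
      eval p x = \<zero> \<Longrightarrow> x \<in> K"
  shows "K = carrier R"
  using assms(1,2) K(1)
proof (induction n arbitrary: H)
  case 0
  interpret finite_automorphism_group R H by fact
  \<comment> \<open>Under the trivial group every orbit is a singleton.\<close>
  have "card (orb x) = 1" if "x \<in> carrier R" for x
    using orbit_stabilizer[OF that] 0 by auto
  then have "carrier R \<subseteq> fixed_points H"
    using fixed_pointI by blast
  then show ?case
    using 0(3) subringE(1)[OF K(2)] by blast
next
  case (Suc n)
  interpret finite_automorphism_group R H by fact
  \<comment> \<open>Sylow's theorem with cofactor \<open>2\<close> gives a subgroup of index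
    2.\<close>
  obtain H' where H': "subgroup H' HG" "card H' = 2 ^ n"
    using sylow_thm[OF two_is_prime_nat group_HG, of n 2] finite_group Suc(3) by (auto simp: order_def)
  show ?case
  proof (cases "fixed_points H' \<subseteq> K")
    case True
    then show ?thesis
      using Suc.IH[OF subgroup_automorphism_group[OF H'(1)] H'(2)] by simp
  next
    case False
    then obtain x where x: "x \<in> fixed_points H'" "x \<notin> K" by blast
    then have xc: "x \<in> carrier R" by (simp add: fixed_points_def)
    obtain k where "card (stab x) = 2 ^ n * k"
      using card_orb_dvd[OF H'(1) x(1)] H'(2) by (auto elim: dvdE)
    \<comment> \<open>The orbit has size 1 or 2. Size 1 would put \<open>x\<close> into the fixed
      points of \<open>H\<close>, hence into \<open>K\<close>. So the orbit polynomial is quadratic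
      over \<open>K\<close>.\<close>
    then have "card (orb x) * k = 2"
      using orbit_stabilizer[OF xc] Suc(3) by simp
    then have "card (orb x) dvd 2"
      by (metis dvd_triv_left)
    moreover have "card (orb x) \<noteq> 1"
      using fixed_pointI[OF xc] Suc(4) x(2) by blast
    ultimately have card: "card (orb x) = 2"
      using prime_nat_iff two_is_prime_nat by blast
    obtain p where p: "p \<in> carrier ((fixed_points H)[X])" "degree p = card (orb x)"
      "\<And>z. z \<in> carrier R \<Longrightarrow> eval p z = \<zero> \<longleftrightarrow> z \<in> orb x"
      using orbit_polynomial[OF xc] by blast
    have "p \<in> carrier (K[X])"
      using p(1) Suc(4) by (auto simp: polynomial_def simp flip: univ_poly_carrier)
    then show ?thesis
      using quadratic[of p x] p(2) p(3)[OF xc] xc orb_refl[OF xc] card x(2) by auto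
  qed
qed

subsection \<open>Extension of homomorphisms and splitting fields\<close>

text \<open>\<open>simple_extension M x\<close> consists of the values at \<open>x\<close> of
  polynomials over \<open>M\<close>. Applying \<open>h\<close> to the coefficients and evaluating at
  \<open>y\<close> kills \<open>Irr M x\<close>, hence every polynomial vanishing at
  \<open>x\<close>, and so descends to these values.\<close>

lemma (in field) simple_extension_hom:
  assumes M: "subfield M R" and h: "h \<in> ring_hom (R\<lparr>carrier := M\<rparr>) R"
    and x: "x \<in> carrier R" "(algebraic over M) x"
    and y: "y \<in> carrier R" "eval (map h (Irr M x)) y = \<zero>"
  obtains g where "g \<in> ring_hom (R\<lparr>carrier := simple_extension M x\<rparr>) R"
    and "\<And>a. a \<in> M \<Longrightarrow> g a = h a" and "g x = y"
proof -
  note subring = subfieldE(1)[OF M]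
  interpret M: field "R\<lparr>carrier := M\<rparr>"
    using subfield_iff(2)[OF M] .
  interpret P: domain "M[X]"
    using univ_poly_is_domain[OF subring] .
  interpret Q: domain "poly_ring R"
    using univ_poly_is_domain[OF carrier_is_subring] .
  define ev where "ev p = eval (map h p) y" for p
  have "map h \<in> ring_hom (M[X]) (poly_ring R)"
    using map_ring_hom_poly_ring[OF h M.field_axioms field_axioms]
    by (simp add: univ_poly_consistent[OF subring])
  then have ev_hom: "ev \<in> ring_hom (M[X]) R"
    using ring_hom_trans[OF _ eval_is_hom[OF carrier_is_subring y(1)]]
    by (simp add: comp_def ev_def[abs_def])
  interpret ev: ring_hom_cring "M[X]" R ev
    by (intro ring_hom_cringI P.is_cring is_cring ev_hom)
  interpret ex: ring_hom_cring "M[X]" R "\<lambda>p. eval p x"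
    by (intro ring_hom_cringI P.is_cring is_cring eval_is_hom subring x(1))
  have kernel: "ev p = \<zero>" if p: "p \<in> carrier (M[X])" "eval p x = \<zero>" for p
  proof -
    have I: "Irr M x \<in> carrier (M[X])"
      using IrrE(1)[OF M x] .
    then obtain q where "q \<in> carrier (M[X])" "p = Irr M x \<otimes>\<^bsub>M[X]\<^esub> q"
      using Irr_minimal[OF M x p] pdivides_iff_shell[OF M I p(1)] by (auto elim: dividesE)
    then show ?thesis
      using I y(2) by (simp add: ev_def[of "Irr M x"])
  qed
  have ev_eq: "ev p = ev q"
    if pq: "p \<in> carrier (M[X])" "q \<in> carrier (M[X])" "eval p x = eval q x" for p q
  proof -
    have "ev (p \<ominus>\<^bsub>M[X]\<^esub> q) = \<zero>"
      using pq by (intro kernel) (auto simp: a_minus_def r_neg)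
    then show ?thesis
      using pq by (simp add: a_minus_def) (metis ev.hom_closed minus_equality minus_minus r_neg a_comm a_inv_closed)
  qed
  \<comment> \<open>Some polynomial with value \<open>z\<close> at \<open>x\<close> is chosen; by
    \<open>ev_eq\<close> the result does not depend on the choice.\<close>
  define g where "g z = ev (SOME p. p \<in> carrier (M[X]) \<and> eval p x = z)" for z
  have g: "g (eval p x) = ev p" if "p \<in> carrier (M[X])" for p
  proof -
    have "(SOME q. q \<in> carrier (M[X]) \<and> eval q x = eval p x) \<in> carrier (M[X]) \<and>
        eval (SOME q. q \<in> carrier (M[X]) \<and> eval q x = eval p x) x = eval p x"
      using that by (intro someI[of "\<lambda>q. q \<in> carrier (M[X]) \<and> eval q x = eval p x" p]) simp
    then show ?thesis
      unfolding g_def using ev_eq that by blast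
  qed
  have img: "simple_extension M x = (\<lambda>p. eval p x) ` carrier (M[X])"
    using simple_extension_as_eval_img[OF subfieldE(3)[OF M] x(1)] .
  have h0: "h \<zero> = \<zero>" "h \<one> = \<one>"
    using ring_hom_zero[OF h M.ring_axioms ring_axioms] ring_hom_memE(4)[OF h] by simp_all
  show ?thesis
  proof
    show "g \<in> ring_hom (R\<lparr>carrier := simple_extension M x\<rparr>) R"
    proof (rule ring_hom_memI)
      fix a assume "a \<in> carrier (R\<lparr>carrier := simple_extension M x\<rparr>)"
      then show "g a \<in> carrier R"
        by (auto simp: img g)
    next
      fix a b assume "a \<in> carrier (R\<lparr>carrier := simple_extension M x\<rparr>)"
        "b \<in> carrier (R\<lparr>carrier := simple_extension M x\<rparr>)"
      then obtain p q where pq: "p \<in> carrier (M[X])" "q \<in> carrier (M[X])" "a = eval p x" "b = eval q x"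
        by (auto simp: img)
      have "g (a \<otimes> b) = ev (p \<otimes>\<^bsub>M[X]\<^esub> q)" "g (a \<oplus> b) = ev (p \<oplus>\<^bsub>M[X]\<^esub> q)"
        using g[OF P.m_closed[OF pq(1,2)]] g[OF P.a_closed[OF pq(1,2)]] pq by simp_all
      then show "g (a \<otimes>\<^bsub>R\<lparr>carrier := simple_extension M x\<rparr>\<^esub> b) = g a \<otimes> g b"
        "g (a \<oplus>\<^bsub>R\<lparr>carrier := simple_extension M x\<rparr>\<^esub> b) = g a \<oplus> g b"
        using pq g by simp_all
    next
      have "\<one> = eval \<one>\<^bsub>M[X]\<^esub> x"
        using ex.hom_one by simp
      then show "g \<one>\<^bsub>R\<lparr>carrier := simple_extension M x\<rparr>\<^esub> = \<one>"
        using g[OF P.one_closed] ev.hom_one by simp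
    qed
    show "g a = h a" if a: "a \<in> M" for a
    \<comment> \<open>The zero polynomial is the empty list, so \<open>[a]\<close> represents
      \<open>a\<close> only if \<open>a\<close> is nonzero.\<close>
    proof (cases "a = \<zero>")
      case True
      then show ?thesis
        using g[OF univ_poly_zero_closed] h0 by (simp add: ev_def)
    next
      case False
      then have "[a] \<in> carrier (M[X])"
        using a by (simp add: polynomial_def flip: univ_poly_carrier)
      moreover have "a \<in> carrier R" "h a \<in> carrier R"
        using a subfieldE(3)[OF M] ring_hom_memE(1)[OF h] by auto
      ultimately show ?thesis
        using g[of "[a]"] by (simp add: ev_def)
    qed
    show "g x = y"
      using g[OF var_closed(1)[OF subring]] x(1) y(1) h0 by (simp add: ev_def var_def)
  qed
qed

lemma (in domain) degree_Irr_pos: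
  assumes "subfield K R" "x \<in> carrier R" "(algebraic over K) x"
  shows "degree (Irr K x) > 0"
  using IrrE(1,2)[OF assms] pirreducibleE(1,2)[OF subfieldE(1)[OF assms(1)]]
    univ_poly_units'[OF assms(1)] by fastforce

lemma (in algebraically_closed) exists_root:
  assumes "p \<in> carrier (poly_ring L)" "degree p > 0"
  obtains x where "x \<in> carrier L" "eval p x = \<zero>"
proof -
  have "roots p \<noteq> {#}"
    using roots_over_carrier[OF assms(1)] assms(2) by (auto simp: splitted_def)
  then obtain x where "x \<in># roots p" by blast
  then show ?thesis
    using that roots_mem_iff_is_root[OF assms(1)] by (auto simp: is_root_def)
qed

text \<open>The elements are adjoined one by one. The minimal polynomial of the next one, carried
  over by the map obtained so far, has a root in the algebraically closed field, and this root can
  serve as the image.\<close>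

lemma (in algebraically_closed) finite_extension_hom:
  assumes M: "subfield M L" and h: "h \<in> ring_hom (L\<lparr>carrier := M\<rparr>) L"
    and xs: "set xs \<subseteq> carrier L" "\<And>x. x \<in> set xs \<Longrightarrow> (algebraic over M) x"
  shows "\<exists>g \<in> ring_hom (L\<lparr>carrier := finite_extension M xs\<rparr>) L. \<forall>a\<in>M. g a = h a"
  using xs
proof (induction xs)
  case Nil
  then show ?case using h by auto
next
  case (Cons x xs)
  let ?N = "finite_extension M xs"
  obtain g where g: "g \<in> ring_hom (L\<lparr>carrier := ?N\<rparr>) L" "\<forall>a\<in>M. g a = h a"
    using Cons by auto
  have N: "subfield ?N L"
    using finite_extension_is_subfield[OF M] Cons(2,3) by simp
  have MN: "M \<subseteq> ?N"
    using finite_extension_incl[OF subfieldE(3)[OF M]] Cons(2) by simp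
  have x: "x \<in> carrier L" "(algebraic over ?N) x"
    using Cons(2,3) algebraic_mono[OF MN] by auto
  have "Irr ?N x \<in> carrier (poly_ring (L\<lparr>carrier := ?N\<rparr>))"
    using IrrE(1)[OF N x] by (simp add: univ_poly_consistent[OF subfieldE(1)[OF N]] del: finite_extension.simps)
  then have "map g (Irr ?N x) \<in> carrier (poly_ring L)"
    using polynomial_hom[OF g(1) subfield_iff(2)[OF N] field_axioms] by blast
  then obtain y where y: "y \<in> carrier L" "eval (map g (Irr ?N x)) y = \<zero>"
    using exists_root degree_Irr_pos[OF N x] by (metis length_map)
  obtain g' where g': "g' \<in> ring_hom (L\<lparr>carrier := simple_extension ?N x\<rparr>) L"
    "\<And>a. a \<in> ?N \<Longrightarrow> g' a = g a"
    using simple_extension_hom[OF N g(1) x y] by blast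
  have "g' \<in> ring_hom (L\<lparr>carrier := finite_extension M (x # xs)\<rparr>) L"
    using g'(1) by simp
  moreover have "g' a = h a" if "a \<in> M" for a
    using g'(2)[OF subsetD[OF MN that]] g(2) that by simp
  ultimately show ?case by blast
qed


section \<open>Splitting fields inside an algebraic closure and their automorphisms\<close>

lemma (in domain) map_fixed_poly:
  assumes "p \<in> carrier (K[X])" "\<forall>a\<in>K. h a = a"
  shows "map h p = p"
  using assms by (intro map_idI) (auto simp: polynomial_def simp flip: univ_poly_carrier)

declare (in ring) finite_extension.simps [simp del]

text \<open>The list is existentially quantified because \<open>finite_extension\<close> adjoins a
  list and no order of the roots is distinguished.\<close>

locale splitting_field = algebraic_closure +
  fixes p and E
  assumes p: "p \<in> carrier (K[X])" "p \<noteq> []"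
    and splitting: "\<exists>xs. set xs = {x. is_root p x} \<and> E = finite_extension K xs"
begin

abbreviation "E_ring \<equiv> L\<lparr>carrier := E\<rparr>"
abbreviation "Gal \<equiv> ring.automorphisms_over E_ring K"

lemma base: "subfield K L" ..

lemma generators:
  obtains xs where "set xs = {x. is_root p x}" "E = finite_extension K xs" "set xs \<subseteq> carrier L"
  using splitting by (auto simp: is_root_def)

lemma subfield_E: "subfield E L"
proof -
  obtain xs where xs: "E = finite_extension K xs" "set xs \<subseteq> carrier L"
    using generators by metis
  show ?thesis
    unfolding xs(1) using finite_extension_is_subfield[OF base xs(2)] algebraic_extension xs(2) by blast
qed

lemma K_subset: "K \<subseteq> E" and roots_subset: "{x. is_root p x} \<subseteq> E"
proof -
  obtain xs where xs: "set xs = {x. is_root p x}" "E = finite_extension K xs" "set xs \<subseteq> carrier L"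
    using generators by metis
  show "K \<subseteq> E"
    unfolding xs(2) by (rule finite_extension_incl[OF subfieldE(3)[OF base] xs(3)])
  show "{x. is_root p x} \<subseteq> E"
    unfolding xs(2) xs(1)[symmetric] by (rule finite_extension_mem[OF subfieldE(1)[OF base] xs(3)])
qed

text \<open>This serves as an induction principle for \<open>E\<close>: a condition that cuts out a
  subring need only be checked on \<open>K\<close> and on the roots of \<open>p\<close>.\<close>

lemma E_minimal:
  assumes "subring M L" "K \<subseteq> M" "{x. is_root p x} \<subseteq> M"
  shows "E \<subseteq> M"
proof -
  obtain xs where xs: "set xs = {x. is_root p x}" "E = finite_extension K xs"
    using generators by metis
  show ?thesis
    unfolding xs(2) using assms xs(1) by (intro finite_extension_subring_incl) simp_all
qed

lemma finite_roots: "finite {x. is_root p x}"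
  using finite_number_of_roots carrier_polynomial_shell[OF subfieldE(1)[OF base] p(1)] by blast

lemma field_E: "field E_ring"
  using subfield_iff(2)[OF subfield_E] .

lemma subset_carrier: "E \<subseteq> carrier L"
  using subfieldE(3)[OF subfield_E] .

lemma hom_into_carrier: "g \<in> ring_hom E_ring E_ring \<Longrightarrow> g \<in> ring_hom E_ring L"
  using subset_carrier by (auto simp: ring_hom_def)

lemma ring_hom_ring_E: "g \<in> ring_hom E_ring L \<Longrightarrow> ring_hom_ring E_ring L g"
  by (intro ring_hom_ringI2 ring_axioms subring_is_ring subfieldE(1) subfield_E)

lemma root_image:
  assumes g: "g \<in> ring_hom E_ring L" "\<forall>a\<in>K. g a = a" and x: "is_root p x"
  shows "is_root p (g x)"
proof -
  interpret g: ring_hom_ring E_ring L g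
    by (rule ring_hom_ring_E[OF g(1)])
  have xE: "x \<in> E" "eval p x = \<zero>" using x roots_subset by (auto simp: is_root_def)
  have "set p \<subseteq> E"
    using p(1) K_subset by (auto simp: polynomial_def simp flip: univ_poly_carrier)
  then have "g (ring.eval E_ring p x) = eval (map g p) (g x)"
    using g.eval_hom' xE(1) by simp
  then have "eval p (g x) = \<zero>"
    using map_fixed_poly[OF p(1) g(2)] xE(2) g.hom_zero
    by (simp add: eval_consistent[OF subfieldE(1)[OF subfield_E]])
  then show ?thesis
    using p(2) g.hom_closed xE(1) by (simp add: is_root_def)
qed

lemma hom_minus:
  assumes "g \<in> ring_hom E_ring L" "x \<in> E"
  shows "g (\<ominus> x) = \<ominus> g x"
proof -
  interpret g: ring_hom_ring E_ring L g by (rule ring_hom_ring_E[OF assms(1)])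
  have x: "x \<in> carrier L" "\<ominus> x \<in> E"
    using assms(2) subset_carrier subringE(5)[OF subfieldE(1)[OF subfield_E]] by auto
  have "g (\<ominus> x) \<oplus> g x = g (\<ominus> x \<oplus> x)"
    using g.hom_add[of "\<ominus> x" x] x assms(2) by simp
  also have "\<dots> = \<zero>"
    using g.hom_zero x by (simp add: l_neg)
  finally show ?thesis
    using g.hom_closed x assms(2) by (intro minus_equality[symmetric]) simp_all
qed

text \<open>Together with \<open>E_minimal\<close> it shows that homomorphisms agreeing on
  \<open>K\<close> and on the roots agree on \<open>E\<close>.\<close>

lemma subring_equalizer:
  assumes "f \<in> ring_hom E_ring L" "g \<in> ring_hom E_ring L"
  shows "subring {x \<in> E. f x = g x} L"
proof -
  interpret f: ring_hom_ring E_ring L f by (rule ring_hom_ring_E[OF assms(1)])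
  interpret g: ring_hom_ring E_ring L g by (rule ring_hom_ring_E[OF assms(2)])
  note E = subringE[OF subfieldE(1)[OF subfield_E]]
  show ?thesis
    using E(1,3,5-7) f.hom_mult g.hom_mult f.hom_add g.hom_add f.hom_one g.hom_one
      hom_minus[OF assms(1)] hom_minus[OF assms(2)]
    by (intro subringI) auto
qed

lemma subring_preimage:
  assumes "g \<in> ring_hom E_ring L"
  shows "subring {x \<in> E. g x \<in> E} L"
proof -
  interpret g: ring_hom_ring E_ring L g by (rule ring_hom_ring_E[OF assms])
  note E = subringE[OF subfieldE(1)[OF subfield_E]]
  show ?thesis
    using E(1,3,5-7) g.hom_mult g.hom_add g.hom_one hom_minus[OF assms]
    by (intro subringI) auto
qed

text \<open>Normality of \<open>E\<close>: an injective map over \<open>K\<close> permutes the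
  finite set of roots. So both the image and the preimage of \<open>E\<close> contain
  \<open>K\<close> and the roots, and \<open>E_minimal\<close> gives the two inclusions.\<close>

lemma image_E:
  assumes g: "g \<in> ring_hom E_ring L" "\<forall>a\<in>K. g a = a"
  shows "g ` E = E" "inj_on g E"
proof -
  interpret g: ring_hom_ring E_ring L g
    by (rule ring_hom_ring_E[OF g(1)])
  show inj: "inj_on g E"
    using non_trivial_field_hom_is_inj[OF g(1) field_E field_axioms] by simp
  have "g ` {x. is_root p x} \<subseteq> {x. is_root p x}"
    using root_image[OF g] by blast
  then have roots: "g ` {x. is_root p x} = {x. is_root p x}"
    using finite_roots inj_on_subset[OF inj roots_subset] by (metis card_image card_subset_eq)
  have K: "K \<subseteq> g ` E"
    using g(2) K_subset by force
  have "E \<subseteq> g ` E"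
    using E_minimal[OF _ K] g.img_is_subring[OF g.R.carrier_is_subring] roots roots_subset
    by (metis (no_types, lifting) image_mono partial_object.select_convs(1) partial_object.surjective
      partial_object.update_convs(1))
  moreover have "E \<subseteq> {x \<in> E. g x \<in> E}"
    using K_subset g(2) roots_subset roots by (intro E_minimal subring_preimage g(1)) auto
  ultimately show "g ` E = E" by blast
qed

lemma Gal_iff: "g \<in> Gal \<longleftrightarrow> g \<in> Bij E \<and> g \<in> ring_hom E_ring E_ring \<and> (\<forall>a\<in>K. g a = a)"
  by (simp add: ring.automorphisms_over_def[OF subring_is_ring[OF subfieldE(1)[OF subfield_E]]])

text \<open>An automorphism over \<open>K\<close> is determined by its values on the finitely many
  roots, which it maps to roots. Extensionality turns agreement on \<open>E\<close> into equality of
  functions.\<close>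

lemma finite_Gal: "finite Gal"
proof (rule inj_on_finite)
  let ?X = "{x. is_root p x}"
  show "finite (?X \<rightarrow>\<^sub>E ?X)"
    using finite_roots by (intro finite_PiE)
  show "(\<lambda>g. restrict g ?X) ` Gal \<subseteq> ?X \<rightarrow>\<^sub>E ?X"
  proof (rule image_subsetI)
    fix g assume "g \<in> Gal"
    then show "restrict g ?X \<in> ?X \<rightarrow>\<^sub>E ?X"
      using root_image[OF hom_into_carrier] by (intro restrict_PiE_iff[THEN iffD2]) (auto simp: Gal_iff)
  qed
  show "inj_on (\<lambda>g. restrict g ?X) Gal"
  proof (rule inj_onI)
    fix f g assume fg: "f \<in> Gal" "g \<in> Gal" and eq: "restrict f ?X = restrict g ?X"
    have "f x = g x" if "is_root p x" for x
      using fun_cong[OF eq, of x] that by simp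
    then have "E \<subseteq> {x \<in> E. f x = g x}"
      using fg hom_into_carrier roots_subset K_subset
      by (intro E_minimal subring_equalizer) (auto simp: Gal_iff)
    moreover have "f \<in> extensional E" "g \<in> extensional E"
      using fg by (auto simp: Gal_iff Bij_def)
    ultimately show "f = g"
      by (intro extensionalityI[of f E g]) auto
  qed
qed

lemma finite_automorphism_group_Gal: "finite_automorphism_group E_ring Gal"
proof (intro finite_automorphism_group.intro finite_automorphism_group_axioms.intro field_E finite_Gal)
  show "subgroup Gal (BijGroup (carrier E_ring))"
    using K_subset
    by (intro ring.subgroup_automorphisms_over subring_is_ring subfieldE(1) subfield_E) simp
  show "Gal \<subseteq> ring_hom E_ring E_ring"
    by (auto simp: Gal_iff)
qed

text \<open>Some homomorphism over \<open>K\<close> sends \<open>x\<close> to its conjugate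
  \<open>y\<close>. It extends to a field containing \<open>E\<close>, and by normality its
  restriction to \<open>E\<close> belongs to \<open>Gal\<close> and thus fixes
  \<open>x\<close>.\<close>

lemma fixed_by_Gal_imp_single_root:
  assumes x: "x \<in> E" "\<forall>g\<in>Gal. g x = x" and y: "y \<in> carrier L" "eval (Irr K x) y = \<zero>"
  shows "y = x"
proof -
  have xc: "x \<in> carrier L" and alg: "(algebraic over K) x"
    using x(1) subset_carrier algebraic_extension by auto
  let ?N = "simple_extension K x"
  have N: "subfield ?N L"
    using simple_extension_is_subfield[OF base xc] alg by simp
  have KN: "K \<subseteq> ?N"
    using simple_extension_incl[OF subfieldE(3)[OF base] xc] .
  have "(\<lambda>a. a) \<in> ring_hom (L\<lparr>carrier := K\<rparr>) L"
    using subfieldE(3)[OF base] by (auto simp: ring_hom_def)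
  then obtain g where g: "g \<in> ring_hom (L\<lparr>carrier := ?N\<rparr>) L" "\<And>a. a \<in> K \<Longrightarrow> g a = a" "g x = y"
    using simple_extension_hom[OF base _ xc alg y(1), of "\<lambda>a. a"] y(2) by auto
  obtain xs where xs: "E = finite_extension K xs" "set xs \<subseteq> carrier L"
    using generators by metis
  have "(algebraic over ?N) z" if "z \<in> set xs" for z
    using algebraic_mono[OF KN] algebraic_extension that xs(2) by blast
  then obtain h where h: "h \<in> ring_hom (L\<lparr>carrier := finite_extension ?N xs\<rparr>) L" "\<forall>a\<in>?N. h a = g a"
    using finite_extension_hom[OF N g(1) xs(2)] by blast
  have EN: "E \<subseteq> finite_extension ?N xs"
    unfolding xs(1) by (rule mono_finite_extension[OF KN])
  \<comment> \<open>Restriction makes the function extensional, as \<open>Bij\<close>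
    demands.\<close>
  define f where "f = restrict h E"
  have E: "subring E L" using subfieldE(1)[OF subfield_E] .
  have f: "f \<in> ring_hom E_ring L"
    using h(1) EN subringE(3,6,7)[OF E] by (auto simp: ring_hom_def f_def subset_iff)
  have fK: "\<forall>a\<in>K. f a = a"
    using g(2) h(2) KN K_subset by (auto simp: f_def)
  have "f \<in> extensional E"
    by (simp add: f_def)
  then have "f \<in> Bij E"
    using image_E[OF f fK] by (simp add: Bij_def bij_betw_def)
  moreover have "f \<in> ring_hom E_ring E_ring"
    using image_E(1)[OF f fK] f by (auto simp: ring_hom_def)
  ultimately have "f \<in> Gal"
    using fK by (simp add: Gal_iff)
  moreover have "f x = y"
    using x(1) h(2) g(3) simple_extension_mem[OF subfieldE(1)[OF base] xc] by (simp add: f_def)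
  ultimately show ?thesis
    using x(2) by blast
qed

end

subsection \<open>Purely inseparable elements\<close>

lemma (in domain) coeff_linear_mult:
  assumes b: "b \<in> carrier R" and p: "p \<in> carrier (poly_ring R)"
  shows "coeff ([\<one>, b] \<otimes>\<^bsub>poly_ring R\<^esub> p) k =
    (if k = 0 then \<zero> else coeff p (k - 1)) \<oplus> b \<otimes> coeff p k"
proof -
  have set: "set p \<subseteq> carrier R"
    using p by (simp add: polynomial_incl flip: univ_poly_carrier)
  \<comment> \<open>For \<open>b\<close> equal to zero the scaled list consists of zeros, hence
    \<open>normalize\<close>; coefficients are insensitive to it.\<close>
  have const_eq: "poly_mult [b] p = normalize (map ((\<otimes>) b) p)"
    using b subsetD[OF set] by (subst poly_mult.simps) (auto simp: poly_mult.simps intro!: poly_add_zero'(1))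
  then have const: "coeff (poly_mult [b] p) k = b \<otimes> coeff p k" for k
    using b by (simp add: scalar_coeff flip: normalize_coeff)
  have const_set: "set (poly_mult [b] p) \<subseteq> carrier R"
    unfolding const_eq using b subsetD[OF set] by (intro normalize_in_carrier) auto
  have "poly_mult [\<one>, b] p = poly_add (map ((\<otimes>) \<one>) p @ [\<zero>]) (poly_mult [b] p)"
    by (simp add: poly_mult.simps)
  also have "map ((\<otimes>) \<one>) p = p"
    using set by (intro map_idI) auto
  finally show ?thesis
    using set const const_set by (simp add: univ_poly_mult poly_add_coeff append_coeff)
qed

text \<open>This is the binomial theorem, obtained from Pascal's rule by splitting off one linear
  factor at a time.\<close>

lemma (in domain) coeff_linear_pow:
  assumes b: "b \<in> carrier R"
  shows "coeff ([\<one>, b] [^]\<^bsub>poly_ring R\<^esub> (n::nat)) k = [(n choose k)] \<cdot> (b [^] (n - k))"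
proof (induction n arbitrary: k)
  case 0
  show ?case
    by (cases k) (simp_all add: univ_poly_one)
next
  case (Suc n)
  interpret P: domain "poly_ring R"
    using univ_poly_is_domain[OF carrier_is_subring] .
  have lin: "[\<one>, b] \<in> carrier (poly_ring R)"
    using b by (simp add: polynomial_def flip: univ_poly_carrier)
  have "coeff ([\<one>, b] [^]\<^bsub>poly_ring R\<^esub> Suc n) k =
      coeff ([\<one>, b] \<otimes>\<^bsub>poly_ring R\<^esub> [\<one>, b] [^]\<^bsub>poly_ring R\<^esub> n) k"
    using lin by (simp add: P.m_comm)
  also have "\<dots> = (if k = 0 then \<zero> else [(n choose (k - 1))] \<cdot> (b [^] (n - (k - 1))))
      \<oplus> b \<otimes> ([(n choose k)] \<cdot> (b [^] (n - k)))"
    using coeff_linear_mult[OF b P.nat_pow_closed[OF lin]] Suc.IH by simp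
  also have "\<dots> = [(Suc n choose k)] \<cdot> (b [^] (Suc n - k))"
  proof (cases k)
    case 0
    then show ?thesis using b by (simp add: m_comm)
  next
    case (Suc j)
    show ?thesis
    \<comment> \<open>Subtraction is truncated: for \<open>j \<ge> n\<close> the two exponents do
      not differ by one, but then \<open>n choose Suc j\<close> vanishes.\<close>
    proof (cases "j < n")
      case True
      then have "n - j = Suc (n - Suc j)" by simp
      then have "b \<otimes> b [^] (n - Suc j) = b [^] (n - j)"
        using b by (simp add: m_comm)
      then show ?thesis
        using Suc b by (simp add: add_pow_rdistr add.nat_pow_mult)
    next
      case False
      then have "n choose Suc j = 0" by simp
      then show ?thesis
        using Suc b False by (simp del: binomial_eq_0_iff)
    qed
  qed
  finally show ?case .
qed

section \<open>Multiples of one and prime characteristic\<close>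

lemma (in ring) add_pow_one_mult: "[(m * n::nat)] \<cdot> \<one> = [m] \<cdot> \<one> \<otimes> [n] \<cdot> \<one>"
  by (simp add: add_pow_ldistr add.nat_pow_pow mult.commute)

text \<open>A vanishing product in a domain has a vanishing factor, so prime factors of
  \<open>n\<close> can be split off until one of them annihilates \<open>\<one>\<close>.\<close>

lemma (in domain) exists_prime_zero:
  assumes "[(n::nat)] \<cdot> \<one> = \<zero>" "n > 0"
  obtains p where "prime p" "p dvd n" "[p] \<cdot> \<one> = \<zero>"
proof -
  have "\<exists>p. prime p \<and> p dvd n \<and> [p] \<cdot> \<one> = \<zero>"
    using assms
  proof (induction n rule: less_induct)
    case (less n)
    then have "n \<noteq> 1" by auto
    then obtain p m where p: "prime p" "n = p * m"
      using prime_factor_nat by (metis dvdE)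
    then have "[p] \<cdot> \<one> \<otimes> [m] \<cdot> \<one> = \<zero>"
      using less(2) by (simp add: add_pow_one_mult)
    then consider "[p] \<cdot> \<one> = \<zero>" | "[m] \<cdot> \<one> = \<zero>"
      using integral_iff by auto
    then show ?case
    proof cases
      case 1
      then show ?thesis using p by auto
    next
      case 2
      then show ?thesis
        using less(1)[of m] less(3) p prime_gt_1_nat[OF p(1)] by auto
    qed
  qed
  then show ?thesis using that by blast
qed

text \<open>If both \<open>p\<close> and \<open>c\<close> annihilated \<open>\<one>\<close>, a
  Bezout relation \<open>c * x = p * y + 1\<close> would make one equal to zero.\<close>

lemma (in domain) add_pow_one_neq_zero:
  assumes "prime p" "[p] \<cdot> \<one> = \<zero>" "\<not> p dvd (c::nat)"
  shows "[c] \<cdot> \<one> \<noteq> \<zero>"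
proof
  assume "[c] \<cdot> \<one> = \<zero>"
  have "coprime p c"
    using assms(1,3) by (rule prime_imp_coprime)
  then have "gcd c p = 1"
    by (simp add: coprime_iff_gcd_eq_1 gcd.commute)
  moreover have "c \<noteq> 0"
    using assms(3) by (intro notI) simp
  ultimately obtain x y where "c * x = p * y + 1"
    using bezout_nat[of c p] by auto
  then have "[(c * x)] \<cdot> \<one> = [(p * y)] \<cdot> \<one> \<oplus> \<one>"
    by (simp del: mult_Suc_right)
  then show False
    using assms(2) \<open>[c] \<cdot> \<one> = \<zero>\<close> by (simp add: add_pow_one_mult)
qed

lemma (in ring) subring_nat_pow: "subring K R \<Longrightarrow> x \<in> K \<Longrightarrow> x [^] (n::nat) \<in> K"
  by (induction n) (auto dest: subringE(3,6))

lemma (in ring) subring_add_pow: "subring K R \<Longrightarrow> x \<in> K \<Longrightarrow> [(n::nat)] \<cdot> x \<in> K"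
  by (induction n) (auto dest: subringE(2,7))

text \<open>Up to sign, the coefficients of \<open>(X - x)^n\<close> are
  \<open>(n choose q) x^q\<close>, so \<open>x^q\<close> is in \<open>K\<close> whenever
  \<open>n choose q\<close> is nonzero in \<open>K\<close>. For \<open>q = 1\<close> this shows that
  some prime \<open>p\<close> dividing \<open>n\<close> vanishes in \<open>K\<close>; the full power
  of \<open>p\<close> in \<open>n\<close> is then a suitable \<open>q\<close>.\<close>

lemma (in field) linear_pow_in_subfield:
  assumes K: "subfield K R" and x: "x \<in> carrier R" "x \<notin> K" and n: "n > 0"
    and pow: "[\<one>, \<ominus> x] [^]\<^bsub>poly_ring R\<^esub> (n::nat) \<in> carrier (K[X])"
  obtains p e m where "prime p" "[p] \<cdot> \<one> = \<zero>" "n = p ^ e * m" "x [^] (p ^ e) \<in> K"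
proof -
  note subring = subfieldE(1)[OF K]
  have coeff_K: "coeff q k \<in> K" if "q \<in> carrier (K[X])" for q k
  proof -
    have "set q \<subseteq> K"
      using that by (simp add: polynomial_incl flip: univ_poly_carrier)
    moreover have "coeff q k \<in> set q \<union> {\<zero>}"
      unfolding coeff_img(3)[of q, symmetric] by (rule rangeI)
    ultimately show ?thesis
      using subringE(2)[OF subring] by auto
  qed
  have binomial: "x [^] q \<in> K" if q: "q \<le> n" "[(n choose q)] \<cdot> \<one> \<noteq> \<zero>" for q
  proof -
    let ?c = "[(n choose q)] \<cdot> \<one>"
    have c: "?c \<in> K - {\<zero>}"
      using subring_add_pow[OF subring subringE(3)[OF subring]] q(2) by simp
    have "[(n choose q)] \<cdot> ((\<ominus> x) [^] q) \<in> K"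
      using coeff_K[OF pow, of "n - q"] coeff_linear_pow[of "\<ominus> x" n "n - q"] x(1) q(1)
        binomial_symmetric[OF q(1)] by simp
    then have "?c \<otimes> (\<ominus> x) [^] q \<in> K"
      using x(1) by (simp add: add_pow_ldistr)
    then have "inv ?c \<otimes> (?c \<otimes> (\<ominus> x) [^] q) \<in> K"
      using subfield_m_inv(1)[OF K c] subringE(6)[OF subring] by blast
    moreover have "inv ?c \<otimes> (?c \<otimes> (\<ominus> x) [^] q) = (\<ominus> x) [^] q"
      using subfield_m_inv(3)[OF K c] c x(1) field_Units m_assoc[of "inv ?c" ?c] by auto
    \<comment> \<open>Multiplication by the same power of minus one removes the sign whatever the
      parity of \<open>q\<close>.\<close>
    ultimately have "(\<ominus> \<one>) [^] q \<otimes> (\<ominus> x) [^] q \<in> K"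
      using subringE(3,5,6)[OF subring] subring_nat_pow[OF subring] by simp
    also have "(\<ominus> \<one>) [^] q \<otimes> (\<ominus> x) [^] q = (\<ominus> \<one> \<otimes> \<ominus> x) [^] q"
      using x(1) by (simp add: nat_pow_distrib)
    also have "\<ominus> \<one> \<otimes> \<ominus> x = x"
      using x(1) by algebra
    finally show ?thesis .
  qed
  have "[n] \<cdot> \<one> = \<zero>"
    using binomial[of 1] x n by auto
  then obtain p where p: "prime p" "p dvd n" "[p] \<cdot> \<one> = \<zero>"
    using exists_prime_zero n by blast
  define e where "e = multiplicity p n"
  obtain m where m: "n = p ^ e * m" "\<not> p dvd m"
    using multiplicity_decompose'[of n p] n p(1) unfolding e_def
    by (metis not_prime_unit gr_implies_not_zero)
  have "m > 0" using m n by (auto intro: gr0I)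
  \<comment> \<open>The prime \<open>p\<close> occurs in \<open>n choose p ^ e\<close> as often as
    in \<open>m\<close>, that is, not at all.\<close>
  then have "multiplicity p (n choose p ^ e) = 0"
    using const_p_fac[OF _ p(1), of m e] m not_dvd_imp_multiplicity_0 by simp
  moreover have "p ^ e \<le> n"
    using m(1) \<open>m > 0\<close> by simp
  \<comment> \<open>Zero has multiplicity \<open>0\<close> as well; \<open>p ^ e \<le> n\<close>
    excludes that case.\<close>
  ultimately have "\<not> p dvd (n choose p ^ e)"
    using p(1) multiplicity_eq_zero_iff[of "n choose p ^ e" p] not_prime_unit
    by (metis binomial_eq_0_iff not_less)
  then have "x [^] (p ^ e) \<in> K"
    using binomial add_pow_one_neq_zero[OF p(1,3)] \<open>p ^ e \<le> n\<close> by blast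
  then show ?thesis
    using that p m(1) by blast
qed

text \<open>The sequence \<open>x\<close>, \<open>x^2\<close>, \<open>x^4\<close>, ... of iterated
  squares starts outside \<open>K\<close> and ends inside, so some member outside \<open>K\<close>
  has its square in \<open>K\<close>.\<close>

lemma (in field) exists_square_in_subfield:
  assumes "x [^] ((2::nat) ^ e) \<in> K" "x \<in> carrier R" "x \<notin> K"
  shows "\<exists>y \<in> carrier R - K. y \<otimes> y \<in> K"
  using assms(1)
proof (induction e)
  case 0
  then show ?case using assms(2,3) by simp
next
  case (Suc e)
  show ?case
  proof (cases "x [^] ((2::nat) ^ e) \<in> K")
    case True
    then show ?thesis by (rule Suc.IH)
  next
    case False
    then show ?thesis
      using Suc(2) assms(2) by (intro bexI[of _ "x [^] ((2::nat) ^ e)"]) (simp_all add: nat_pow_mult mult_2)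
  qed
qed

text \<open>With multiplicities \<open>f\<close> has as many roots as its degree, and all are
  \<open>x\<close>, so the power of \<open>X - x\<close> divides \<open>f\<close>. Equal degrees
  make the cofactor constant, and the leading coefficients make it one.\<close>

lemma (in algebraically_closed) single_root_imp_linear_pow:
  assumes f: "f \<in> carrier (poly_ring L)" "f \<noteq> []" "lead_coeff f = \<one>" and x: "x \<in> carrier L"
    and root: "\<And>y. y \<in> carrier L \<Longrightarrow> eval f y = \<zero> \<Longrightarrow> y = x"
  shows "f = [\<one>, \<ominus> x] [^]\<^bsub>poly_ring L\<^esub> degree f"
proof -
  interpret P: domain "poly_ring L"
    using univ_poly_is_domain[OF carrier_is_subring] .
  let ?n = "degree f"
  let ?q = "[\<one>, \<ominus> x] [^]\<^bsub>poly_ring L\<^esub> ?n"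
  have lin: "[\<one>, \<ominus> x] \<in> carrier (poly_ring L)"
    using x by (simp add: polynomial_def flip: univ_poly_carrier)
  have q: "?q \<in> carrier (poly_ring L)" "?q \<noteq> []" "degree ?q = ?n"
    using lin polynomial_pow_not_zero[OF lin, of ?n] polynomial_pow_degree[OF lin, of ?n] by auto
  have "lead_coeff ?q = coeff ?q ?n"
    using lead_coeff_simp[OF q(2)] q(3) by simp
  then have lead: "lead_coeff ?q = \<one>"
    using coeff_linear_pow[of "\<ominus> x" ?n ?n] x by simp
  have "\<forall>y\<in>#roots f. y = x"
    using roots_mem_iff_is_root[OF f(1)] root by (auto simp: is_root_def)
  then have "count (roots f) x = size (roots f)"
    using set_mset_subset_singletonD[of "roots f" x] by (metis count_replicate_mset singleton_iff subsetI)
  then have "alg_mult f x = ?n"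
    using roots_over_carrier[OF f(1)] alg_mult_eq_count_roots[OF f(1)] by (simp add: splitted_def)
  then have "?q pdivides f"
    using le_alg_mult_imp_pdivides[OF x f(1)] by simp
  then obtain r where r: "r \<in> carrier (poly_ring L)" "f = ?q \<otimes>\<^bsub>poly_ring L\<^esub> r"
    by (auto simp: pdivides_def elim: dividesE)
  then have r0: "r \<noteq> []"
    using f(2) q(1) P.r_null by (auto simp: univ_poly_zero)
  have "?n = ?n + degree r"
    using poly_mult_degree_eq[OF carrier_is_subring, of ?q r] r r0 q
    by (simp add: univ_poly_mult univ_poly_carrier)
  then obtain c where c: "r = [c]"
    using r0 by (cases r) auto
  have "lead_coeff f = lead_coeff ?q \<otimes> lead_coeff r"
    using poly_mult_lead_coeff[OF carrier_is_subring, of ?q r] r r0 q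
    by (simp add: univ_poly_mult univ_poly_carrier)
  moreover have "c \<in> carrier L"
    using r(1) by (simp add: c polynomial_def flip: univ_poly_carrier)
  ultimately have "r = \<one>\<^bsub>poly_ring L\<^esub>"
    using f(3) lead c by (simp add: univ_poly_one)
  then show ?thesis
    using r(2) q(1) by simp
qed

lemma (in domain) degree_Irr_eq_one_imp_mem:
  assumes "subfield K R" "x \<in> carrier R" "(algebraic over K) x" "degree (Irr K x) = 1"
  shows "x \<in> K"
proof -
  obtain b where b: "Irr K x = [\<one>, b]"
    using IrrE(3)[OF assms(1-3)] assms(4)
    by (metis One_nat_def Suc_diff_1 length_0_conv length_Suc_conv length_greater_0_conv list.sel(1) zero_neq_one diff_0_eq_0 list.size(3))
  have bK: "b \<in> K"
    using IrrE(1)[OF assms(1-3)] by (simp add: b polynomial_def flip: univ_poly_carrier)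
  then have "b \<in> carrier R"
    using subfieldE(3)[OF assms(1)] by blast
  then have "x \<oplus> b = \<zero>"
    using IrrE(4)[OF assms(1-3)] assms(2) by (simp add: b)
  then have "x = \<ominus> b"
    using \<open>b \<in> carrier R\<close> assms(2) minus_equality by metis
  then show ?thesis
    using subringE(5)[OF subfieldE(1)[OF assms(1)] bK] by simp
qed

lemma (in domain) degree_Irr_le:
  assumes K: "subfield K R" "x \<in> carrier R" "(algebraic over K) x"
    and p: "p \<in> carrier (K[X])" "p \<noteq> []" "eval p x = \<zero>"
  shows "degree (Irr K x) \<le> degree p"
  using pdivides_imp_degree_le[OF subfieldE(1)[OF K(1)] IrrE(1)[OF K] p(1,2) Irr_minimal[OF K p(1,3)]] .

lemma (in domain) degree_Irr_le_of_pow_mem: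
  assumes K: "subfield K R" "x \<in> carrier R" "(algebraic over K) x"
    and n: "n > 0" "x [^] (n::nat) \<in> K"
  shows "degree (Irr K x) \<le> n"
proof -
  \<comment> \<open>Lists start with the leading coefficient, so this is \<open>X^n - c\<close> with
    \<open>c\<close> the \<open>n\<close>-th power of \<open>x\<close>: appending an entry
    multiplies the monomial of exponent \<open>n - 1\<close> by \<open>X\<close>.\<close>
  let ?p = "monom \<one> (n - 1) @ [\<ominus> (x [^] n)]"
  note subring = subfieldE(1)[OF K(1)]
  have "?p \<in> carrier (K[X])"
    using subringE(2,3)[OF subring] subringE(5)[OF subring n(2)]
    by (simp add: polynomial_def monom_def subset_iff flip: univ_poly_carrier)
  moreover have "eval ?p x = \<zero>"
  proof -
    have "eval ?p x = eval (monom \<one> (n - 1)) x \<otimes> x \<oplus> \<ominus> (x [^] n)"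
      using K(2) by (intro eval_append_aux monom_in_carrier) auto
    also have "eval (monom \<one> (n - 1)) x \<otimes> x = x [^] Suc (n - 1)"
      using eval_monom[OF one_closed K(2), of "n - 1"] K(2) by simp
    also have "x [^] Suc (n - 1) \<oplus> \<ominus> (x [^] n) = \<zero>"
      using K(2) n(1) by (simp add: r_neg del: nat_pow_Suc)
    finally show ?thesis .
  qed
  ultimately show ?thesis
    using degree_Irr_le[OF K, of ?p] n(1) by (simp add: monom_def)
qed

text \<open>Over \<open>K\<close> every irreducible polynomial of degree \<open>> 1\<close> has even degree. So an element that is
  purely inseparable over \<open>K\<close> and not in \<open>K\<close> can only exist in characteristic \<open>2\<close>.\<close>
lemma (in algebraic_closure) single_root_imp_char_two:
  assumes odd: "\<And>p. p \<in> carrier (K[X]) \<Longrightarrow> odd (degree p) \<Longrightarrow> degree p > 1 \<Longrightarrow> \<not> pirreducible K p"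
    and x: "x \<in> carrier L" "x \<notin> K"
    and root: "\<And>y. y \<in> carrier L \<Longrightarrow> eval (Irr K x) y = \<zero> \<Longrightarrow> y = x"
  shows "\<one> \<oplus> \<one> = \<zero>" "\<exists>y \<in> carrier L - K. y \<otimes> y \<in> K"
proof -
  have K: "subfield K L" ..
  have alg: "(algebraic over K) x" by (rule algebraic_extension[OF x(1)])
  note Irr = IrrE[OF K x(1) alg]
  let ?n = "degree (Irr K x)"
  have Irr0: "Irr K x \<noteq> []"
    using pirreducibleE(1)[OF subfieldE(1)[OF K] Irr(1,2)] .
  have "Irr K x \<notin> Units (K[X])"
    using pirreducibleE(2)[OF subfieldE(1)[OF K] Irr(1,2)] .
  then have n: "?n > 0"
    using univ_poly_units'[OF K] Irr(1) Irr0 by simp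
  have "?n \<noteq> 1"
    using degree_Irr_eq_one_imp_mem[OF K x(1) alg] x(2) by blast
  then have even: "even ?n"
    using odd[OF Irr(1)] Irr(2) n by fastforce
  have "Irr K x = [\<one>, \<ominus> x] [^]\<^bsub>poly_ring L\<^esub> ?n"
    by (intro single_root_imp_linear_pow carrier_polynomial_shell[OF subfieldE(1)[OF K]] Irr Irr0 x root)
  then have "[\<one>, \<ominus> x] [^]\<^bsub>poly_ring L\<^esub> ?n \<in> carrier (K[X])"
    using Irr(1) by simp
  then obtain p e m where p: "prime p" "[p] \<cdot> \<one> = \<zero>" "?n = p ^ e * m" "x [^] (p ^ e) \<in> K"
    using linear_pow_in_subfield[OF K x n] by blast
  \<comment> \<open>The degree \<open>p ^ e * m\<close> is at most \<open>p ^ e\<close>, hence equal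
    to it. As it is even, the prime \<open>p\<close> must be 2.\<close>
  have "?n \<le> p ^ e"
    using degree_Irr_le_of_pow_mem[OF K x(1) alg _ p(4)] prime_gt_0_nat[OF p(1)] by simp
  then have "?n = p ^ e"
    using p(3) n by (cases m) auto
  then have "even p"
    using even by (metis even_power)
  then have two: "p = 2"
    using p(1) primes_dvd_imp_eq two_is_prime_nat by blast
  show "\<one> \<oplus> \<one> = \<zero>"
    using p(2) by (simp add: two numeral_2_eq_2)
  show "\<exists>y \<in> carrier L - K. y \<otimes> y \<in> K"
    using exists_square_in_subfield p(4) x by (simp add: two)
qed

subsection \<open>Roots of polynomials of odd degree and of degree two\<close>

text \<open>A polynomial of odd degree above 1 is a product of two nonconstant factors, and one of
  their degrees is odd. The induction ends in degree 1, where the root lies in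
  \<open>K\<close>.\<close>

lemma (in algebraic_closure) odd_degree_imp_root:
  assumes odd: "\<And>p. p \<in> carrier (K[X]) \<Longrightarrow> odd (degree p) \<Longrightarrow> degree p > 1 \<Longrightarrow> \<not> pirreducible K p"
    and p: "p \<in> carrier (K[X])" "odd (degree p)"
  shows "\<exists>x\<in>K. eval p x = \<zero>"
  using p
proof (induction "degree p" arbitrary: p rule: less_induct)
  case (less p)
  have K: "subfield K L" ..
  note subring = subfieldE(1)[OF K]
  interpret P: domain "K[X]"
    using univ_poly_is_domain[OF subring] .
  show ?case
  proof (cases "degree p = 1")
    case True
    then show ?thesis
      using degree_one_root[OF K less(2)] subringE(5)[OF subring] by blast
  next
    case False
    then have deg: "degree p > 1"
      using less(3) by (cases "degree p") auto
    then have p0: "p \<noteq> []" by auto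
    have nonunit: "p \<notin> Units (K[X])"
      using univ_poly_units'[OF K, of p] deg by linarith
    have "\<exists>q\<in>carrier (K[X]). \<exists>r\<in>carrier (K[X]). p = q \<otimes>\<^bsub>K[X]\<^esub> r \<and>
        q \<notin> Units (K[X]) \<and> r \<notin> Units (K[X])"
    proof (rule ccontr)
      assume "\<not> (\<exists>q\<in>carrier (K[X]). \<exists>r\<in>carrier (K[X]). p = q \<otimes>\<^bsub>K[X]\<^esub> r \<and>
        q \<notin> Units (K[X]) \<and> r \<notin> Units (K[X]))"
      then have "pirreducible K p"
        using nonunit by (intro pirreducibleI[OF subring less(2) p0]) blast+
      then show False
        using odd[OF less(2,3) deg] by blast
    qed
    then obtain q r where qr: "q \<in> carrier (K[X])" "r \<in> carrier (K[X])" "p = q \<otimes>\<^bsub>K[X]\<^esub> r"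
      "q \<notin> Units (K[X])" "r \<notin> Units (K[X])"
      by blast
    have ne: "q \<noteq> []" "r \<noteq> []"
      using p0 qr(1-3) P.l_null P.r_null by (auto simp: univ_poly_zero)
    then have pos: "degree q > 0" "degree r > 0"
      using univ_poly_units'[OF K, of q] univ_poly_units'[OF K, of r] qr
      by (metis neq0_conv)+
    have sum: "degree p = degree q + degree r"
      using poly_mult_degree_eq[OF subring, of q r] qr(1-3) ne
      by (simp add: univ_poly_mult univ_poly_carrier)
    have lt: "degree q < degree p" "degree r < degree p"
      using sum pos by linarith+
    have eval: "eval p x = eval q x \<otimes> eval r x" "eval q x \<in> carrier L" "eval r x \<in> carrier L"
      if "x \<in> K" for x
    proof -
      have "(\<lambda>p. eval p x) \<in> ring_hom (K[X]) L"
        using eval_is_hom[OF subring] that subfieldE(3)[OF K] by blast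
      then show "eval p x = eval q x \<otimes> eval r x" "eval q x \<in> carrier L" "eval r x \<in> carrier L"
        using ring_hom_memE(1,2) qr(1-3) by fastforce+
    qed
    consider "odd (degree q)" | "odd (degree r)"
      using less(3)[unfolded sum] odd_add by blast
    then show ?thesis
    proof cases
      case 1
      then obtain x where x: "x \<in> K" "eval q x = \<zero>"
        using less(1)[OF lt(1) qr(1) 1] by blast
      then have "eval p x = \<zero>"
        using eval[OF x(1)] by simp
      then show ?thesis using x(1) by blast
    next
      case 2
      then obtain x where x: "x \<in> K" "eval r x = \<zero>"
        using less(1)[OF lt(2) qr(2) 2] by blast
      then have "eval p x = \<zero>"
        using eval[OF x(1)] by simp
      then show ?thesis using x(1) by blast
    qed
  qed
qed

text \<open>Otherwise the minimal polynomial of \<open>x\<close> has degree exactly 2, and adjoining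
  \<open>x\<close> to \<open>K\<close> gives a quadratic extension.\<close>

lemma (in domain) quadratic_root_mem:
  assumes K: "subfield K R" "\<nexists>E. quadratic_extension K E"
    and p: "p \<in> carrier (K[X])" "degree p = 2" and x: "x \<in> carrier R" "eval p x = \<zero>"
  shows "x \<in> K"
proof (rule ccontr)
  assume "x \<notin> K"
  have p0: "p \<noteq> []" using p(2) by auto
  have alg: "(algebraic over K) x"
    by (rule algebraicI[OF p(1) p0 x(2)])
  have "degree (Irr K x) \<le> 2"
    using degree_Irr_le[OF K(1) x(1) alg p(1) p0 x(2)] p(2) by simp
  moreover have "degree (Irr K x) \<noteq> 1"
    using degree_Irr_eq_one_imp_mem[OF K(1) x(1) alg] \<open>x \<notin> K\<close> by blast
  moreover have "degree (Irr K x) > 0"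
    by (rule degree_Irr_pos[OF K(1) x(1) alg])
  ultimately have "degree (Irr K x) = 2" by linarith
  then have "dimension 2 K (simple_extension K x)"
    using dimension_simple_extension[OF K(1) x(1) alg] by simp
  then have "quadratic_extension K (simple_extension K x)"
    using simple_extension_is_subfield[OF K(1) x(1)] alg K(1)
      simple_extension_incl[OF subfieldE(3)[OF K(1)] x(1)]
    by (simp add: quadratic_extension_def over_def)
  then show False using K(2) by blast
qed

section \<open>The field generated by a square root of minus one\<close>

theorem theorem5p1:
  fixes L :: "('a, 'b) ring_scheme" (structure) and F :: "'a set" and i :: 'a
  assumes "algebraic_closure L F"
    and "i \<in> carrier L" and "i [^] (2::nat) \<oplus> \<one> = \<zero>"
    and "\<nexists>E. ring.quadratic_extension L (generate_field L (insert i F)) E"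
    and "\<And>p. p \<in> carrier (F[X]\<^bsub>L\<^esub>) \<Longrightarrow> odd (degree p) \<Longrightarrow> degree p > 1 \<Longrightarrow>
           \<not> pirreducible\<^bsub>L\<^esub> F p"
  shows "algebraically_closed (L\<lparr>carrier := generate_field L (insert i F)\<rparr>)"
proof -
  interpret algebraic_closure L F by fact
  define M where "M = generate_field L (insert i F)"
  have F: "subfield F L" ..
  have gen: "insert i F \<subseteq> carrier L"
    using assms(2) subfieldE(3)[OF F] by simp
  have M: "subfield M L"
    unfolding M_def by (rule generate_field_is_subfield[OF gen])
  have FM: "F \<subseteq> M" "i \<in> M"
    using generate_fieldE(2)[OF gen M_def] by auto
  have ii: "i \<otimes> i = \<ominus> \<one>"
  proof -
    have "i \<otimes> i \<oplus> \<one> = \<zero>"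
      using assms(2,3) by (simp add: numeral_2_eq_2)
    then show ?thesis
      using minus_equality[of "i \<otimes> i" \<one>] assms(2) by simp
  qed
  have quadratic: "x \<in> M" if "p \<in> carrier (M[X])" "degree p = 2" "x \<in> carrier L" "eval p x = \<zero>" for p x
    using quadratic_root_mem[OF M] assms(4) that unfolding M_def by blast
  \<comment> \<open>In characteristic 2 the square of \<open>i \<oplus> \<one>\<close> vanishes, so
    \<open>i\<close> is in \<open>F\<close> and \<open>M\<close> is \<open>F\<close>. But
    \<open>y\<close> is a root of the quadratic polynomial \<open>X^2 - y^2\<close> over
    \<open>M\<close> and hence in \<open>M\<close>.\<close>
  have char_two: False if "\<one> \<oplus> \<one> = \<zero>" "y \<in> carrier L - F" "y \<otimes> y \<in> F" for y
  proof -
    have "(i \<oplus> \<one>) \<otimes> (i \<oplus> \<one>) = (i \<otimes> i \<oplus> \<one>) \<oplus> i \<otimes> (\<one> \<oplus> \<one>)"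
      using assms(2) by algebra
    also have "\<dots> = \<zero>"
      using ii that(1) assms(2) by (simp add: l_neg)
    finally have "i \<oplus> \<one> = \<zero>"
      using integral assms(2) by blast
    then have "i = \<ominus> \<one>"
      using minus_equality[of i \<one>] assms(2) by simp
    then have "i \<in> F"
      using subringE(3,5)[OF subfieldE(1)[OF F]] by simp
    then have "M \<subseteq> F"
      unfolding M_def by (intro generate_field_min_subfield1 gen F) simp
    have yy: "\<ominus> (y \<otimes> y) \<in> M" "\<zero> \<in> M" "\<one> \<in> M"
      using subringE(2,3,5)[OF subfieldE(1)[OF M]] that(3) FM(1) by auto
    then have "[\<one>, \<zero>, \<ominus> (y \<otimes> y)] \<in> carrier (M[X])"
      by (simp add: polynomial_def flip: univ_poly_carrier)
    moreover have "eval [\<one>, \<zero>, \<ominus> (y \<otimes> y)] y = \<zero>"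
      using that(2) by (simp add: numeral_2_eq_2 r_neg)
    ultimately have "y \<in> M"
      using quadratic that(2) by simp
    then show False
      using \<open>M \<subseteq> F\<close> that(2) by blast
  qed
  \<comment> \<open>As \<open>L\<close> is algebraically closed, it is enough that \<open>M\<close>
    is all of \<open>L\<close>.\<close>
  have "x \<in> M" if x: "x \<in> carrier L" for x
  proof -
    let ?a = "Irr F x" and ?b = "Irr F i"
    interpret P: domain "F[X]"
      using univ_poly_is_domain[OF subfieldE(1)[OF F]] .
    note a = IrrE[OF F x algebraic_extension[OF x]]
    note b = IrrE[OF F assms(2) algebraic_extension[OF assms(2)]]
    have a0: "?a \<noteq> []" and b0: "?b \<noteq> []"
      using pirreducibleE(1)[OF subfieldE(1)[OF F]] a b by blast+
    \<comment> \<open>The factor \<open>?b\<close> is there to make the splitting field contain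
      \<open>i\<close> as well as \<open>x\<close>.\<close>
    define p where "p = ?a \<otimes>\<^bsub>F[X]\<^esub> ?b"
    have p: "p \<in> carrier (F[X])" "p \<noteq> []"
      using a(1) b(1) a0 b0 P.integral[of ?a ?b] by (auto simp: p_def univ_poly_zero)
    have eval_p: "eval p y = eval ?a y \<otimes> eval ?b y" if "y \<in> carrier L" for y
      using ring_hom_memE(2)[OF eval_is_hom[OF subfieldE(1)[OF F] that] a(1) b(1)]
      by (simp add: p_def)
    have eval_closed: "eval q y \<in> carrier L" if "y \<in> carrier L" "q \<in> carrier (F[X])" for q y
      using ring_hom_memE(1)[OF eval_is_hom[OF subfieldE(1)[OF F] that(1)] that(2)] .
    have "finite {y. is_root p y}"
      using finite_number_of_roots carrier_polynomial_shell[OF subfieldE(1)[OF F] p(1)] by blast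
    then obtain xs where xs: "set xs = {y. is_root p y}"
      using finite_list by blast
    define E where "E = finite_extension F xs"
    interpret splitting_field L F p E
      using p xs E_def by unfold_locales blast+
    have roots: "x \<in> E" "i \<in> E"
      using roots_subset p(2) x assms(2) eval_p eval_closed a(1,4) b(1,4) by (auto simp: is_root_def)
    note E = subfieldE(1)[OF subfield_E]
    interpret E: field E_ring by (rule field_E)
    interpret G: finite_automorphism_group E_ring Gal by (rule finite_automorphism_group_Gal)
    \<comment> \<open>An element fixed by \<open>Gal\<close> is the only root of its minimal
      polynomial. Outside \<open>F\<close> it would force characteristic 2 and an element outside
      \<open>F\<close> with square in \<open>F\<close>, which \<open>char_two\<close>
      excludes.\<close>
    have fixed: "E.fixed_points Gal = F"
    proof
      show "F \<subseteq> E.fixed_points Gal"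
      proof
        fix y assume y: "y \<in> F"
        then have "g y = y" if "g \<in> Gal" for g
          using that unfolding Gal_iff by blast
        then show "y \<in> E.fixed_points Gal"
          using subsetD[OF K_subset y] by (simp add: E.fixed_points_def)
      qed
      show "E.fixed_points Gal \<subseteq> F"
      proof
        fix y assume y: "y \<in> E.fixed_points Gal"
        then have yE: "y \<in> E" "\<forall>g\<in>Gal. g y = y"
          unfolding E.fixed_points_def by simp_all
        show "y \<in> F"
        proof (rule ccontr)
          assume "y \<notin> F"
          note y' = subsetD[OF subset_carrier yE(1)] this fixed_by_Gal_imp_single_root[OF yE]
          show False
            using char_two[OF single_root_imp_char_two(1)[OF assms(5) y']]
              single_root_imp_char_two(2)[OF assms(5) y'] by blast
        qed
      qed
    qed
    have "card Gal \<noteq> 0"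
      using finite_Gal subgroup.one_closed[OF G.subgroup_BijGroup] by auto
    then obtain m' where "card Gal = 2 ^ multiplicity 2 (card Gal) * m'" "odd m'"
      by (rule multiplicity_decompose'[of _ 2]) simp
    then obtain a m where m: "card Gal = 2 ^ a * m" "odd m"
      by blast
    have "order G.HG = 2 ^ a * m" "finite (carrier G.HG)"
      using m(1) finite_Gal by (simp_all add: order_def)
    then obtain P where P: "subgroup P G.HG" "card P = 2 ^ a"
      using sylow_thm[OF two_is_prime_nat G.group_HG] by blast
    \<comment> \<open>Polynomials over \<open>F\<close> and their values at elements of
      \<open>F\<close> are the same in \<open>E_ring\<close> as in \<open>L\<close>, so
      \<open>odd_degree_imp_root\<close> carries over.\<close>
    have "\<exists>y\<in>E.fixed_points Gal. E.eval q y = \<zero>\<^bsub>E_ring\<^esub>"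
      if "q \<in> carrier ((E.fixed_points Gal)[X]\<^bsub>E_ring\<^esub>)" "odd (degree q)" for q
      using odd_degree_imp_root[OF assms(5), of q] that unfolding fixed
      by (simp add: univ_poly_consistent[OF E] eval_consistent[OF E])
    then have fixed_P: "E.fixed_points P = F"
      using G.sylow_fixed_points[OF P m] unfolding fixed by blast
    interpret P: finite_automorphism_group E_ring P
      by (rule G.subgroup_automorphism_group[OF P(1)])
    have ME: "M \<subseteq> E"
      unfolding M_def using roots(2) K_subset
      by (intro generate_field_min_subfield1 gen subfield_E) simp
    then have ME': "subfield M E_ring"
      using E.subfield_iff(1)[of M] subfield_iff(2)[OF M] by simp
    have minus_one: "i \<otimes>\<^bsub>E_ring\<^esub> i = \<ominus>\<^bsub>E_ring\<^esub> \<one>\<^bsub>E_ring\<^esub>"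
      using E.minus_equality[of "i \<otimes> i" \<one>] subringE(3)[OF E]
        subringE(5)[OF E subringE(3)[OF E]] roots(2) ii by (simp add: l_neg)
    \<comment> \<open>The stabilizer is formed inside \<open>P\<close>, which makes it a 2-group; as
      \<open>P\<close> fixes only \<open>F\<close>, the fixed points of the stabilizer lie in
      \<open>M\<close>.\<close>
    have Q: "E.fixed_points (P.stab i) \<subseteq> M"
      using P.fixed_points_stab_sqrt_minus_one[OF _ minus_one ME'] roots(2) fixed_P FM by simp
    have "card (P.stab i) dvd card P"
      using P.orbit_stabilizer[of i] roots(2) by (metis dvd_triv_right partial_object.select_convs(1) partial_object.surjective partial_object.update_convs(1))
    then obtain n where card_stab: "card (P.stab i) = 2 ^ n"
      unfolding P(2) using divides_primepow_nat[OF two_is_prime_nat] by blast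
    have iE: "i \<in> carrier E_ring" using roots(2) by simp
    \<comment> \<open>The absence of quadratic extensions of \<open>M\<close> enters through
      \<open>quadratic\<close>, which concerns roots in \<open>L\<close> and so covers those in
      \<open>E\<close>.\<close>
    have "M = carrier E_ring"
    proof (rule E.two_group_fixed_points[OF P.subgroup_automorphism_group[OF P.subgroup_stab[OF iE]]
          card_stab Q subfieldE(1)[OF ME']])
      fix q y assume "q \<in> carrier (M[X]\<^bsub>E_ring\<^esub>)" "degree q = 2" "y \<in> carrier E_ring"
        "E.eval q y = \<zero>\<^bsub>E_ring\<^esub>"
      then show "y \<in> M"
        using quadratic[of q y] subset_carrier
        by (auto simp: univ_poly_consistent[OF E] eval_consistent[OF E])
    qed
    then show "x \<in> M" using roots(1) by simp
  qed
  then have "M = carrier L"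
    using subfieldE(3)[OF M] by blast
  then show ?thesis
    using algebraically_closed_axioms by (simp flip: M_def)
qed

end
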